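(* Let $\{(W_j,P_{W_j})\}_{j\in J}$ be an $f$-basis system for $\mathcal{H}$. Then $\{(W_j,P_{W_j})\}_{j\in J}$ is a Bessel $f$-basis system if and only if $\{(P_{W_j}^*(W_j),P_{W_j}^* )\}_{j\in J}$ is a Hilbert $f$-basis system.
   Context: $\mathcal{H}$ is a separable Hilbert space and $J$ is a countable (or finite) index set. A sequence $\{W_j\}_{j\in J}$ of closed subspaces of $\mathcal{H}$ is an $f$-basis (fusion Schauder basis) for $\mathcal{H}$ if for every $f\in\mathcal{H}$ there exists a unique sequence $\{g_j\}_{j\in J}$ with $g_j\in W_j$ such that $f=\sum_{j\in J}g_j$, with convergence in norm. In that case $P_{W_j}:\mathcal{H}\to W_j$, $P_{W_j}f=g_j$; $\{P_{W_j}\}_{j\in J}$ is called the $f$-dual sequence of $\{W_j\}_{j\in J}$, and $\{(W_j,P_{W_j})\}_{j\in J}$ is called an $f$-basis system. The operators $P_{W_j}$ are bounded; they are regarded as operators on $\mathcal{H}$ and $P_{W_j}^*$ denotes the adjoint. Write $\big(\sum_{j\in J}\oplus W_j\big)_{\ell^2}=\{\{g_j\}_{j\in J} : g_j\in W_j,\ \sum_{j\in J}\|g_j\|^2<\infty\}$. An $f$-basis $\{W_j\}_{j\in J}$ is a Bessel $f$-basis if, for $g_j\in W_j$, convergence of $\sum_{j\in J}g_j$ implies $\{g_j\}_{j\in J}\in\big(\sum_{j\in J}\oplus W_j\big)_{\ell^2}$; it is a Hilbert $f$-basis if $\sum_{j\in J}g_j$ converges for every $\{g_j\}_{j\in J}\in\big(\sum_{j\in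 J}\oplus W_j\big)_{\ell^2}$. A Bessel (resp. Hilbert) $f$-basis system is an $f$-basis system whose underlying $f$-basis is a Bessel (resp. Hilbert) $f$-basis. *)

theory Defs
  imports "HOL-Analysis.Analysis"
begin

text \<open>
  A normed field that is a copy of the reals or of the complex numbers, with its conjugation.
  The last axiom makes every element \<open>x\<close> a root of a real quadratic polynomial, so no other field
  qualifies.
\<close>

class conj_field = real_normed_field +
  fixes conj :: "'a \<Rightarrow> 'a"
  assumes conj_add: "conj (x + y) = conj x + conj y"
    and conj_mult: "conj (x * y) = conj x * conj y"
    and conj_of_real: "conj (r *\<^sub>R 1) = r *\<^sub>R 1"
    and mult_conj: "x * conj x = (norm x)\<^sup>2 *\<^sub>R 1"

instantiation real :: conj_field
begin
definition conj_real :: "real \<Rightarrow> real" where "conj_real x = x"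
instance by standard (simp_all add: conj_real_def power2_eq_square)
end

instantiation complex :: conj_field
begin
definition conj_complex :: "complex \<Rightarrow> complex" where "conj_complex = cnj"
instance
  by standard
    (simp_all add: conj_complex_def scaleR_conv_of_real complex_norm_square del: of_real_power)
end

text \<open>
  A separable Hilbert space over \<open>'k\<close>. Topology and completeness come from the type class
  \<^class>\<open>banach\<close>; the inner product is linear in its first argument and induces the norm.
\<close>

locale separable_hilbert_space = vector_space smul
  for smul :: "'k::conj_field \<Rightarrow> 'a::banach \<Rightarrow> 'a" +
  fixes ip :: "'a \<Rightarrow> 'a \<Rightarrow> 'k"
  assumes smul_of_real: "smul (of_real r) x = r *\<^sub>R x"
    and ip_add: "ip (x + y) z = ip x z + ip y z"
    and ip_smul: "ip (smul c x) y = c * ip x y"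
    and ip_conj: "ip y x = conj (ip x y)"
    and ip_norm: "ip x x = of_real ((norm x)\<^sup>2)"
    and separable: "separable_space (euclidean :: 'a topology)"

lemma separable_hilbert_space_real:
  assumes "separable_space (euclidean :: 'a::{real_inner,banach} topology)"
  shows "separable_hilbert_space (scaleR :: real \<Rightarrow> 'a \<Rightarrow> 'a) inner"
  using assms
  by unfold_locales
    (simp_all add: algebra_simps inner_add_left conj_real_def inner_commute power2_norm_eq_inner)

definition hilbert_adjoint :: "('a \<Rightarrow> 'a \<Rightarrow> 'k) \<Rightarrow> ('a \<Rightarrow> 'a) \<Rightarrow> 'a \<Rightarrow> 'a" where
  "hilbert_adjoint ip T = (THE S. \<forall>x y. ip (T x) y = ip x (S y))"

text \<open>
  The countable (possibly finite) index set \<open>J\<close> is enumerated by a map \<open>e\<close> into the naturals that is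
  injective on \<open>J\<close>; as usual for Schauder bases, a series over \<open>J\<close> is the limit of its partial sums
  in that order. For finite \<open>J\<close> the partial sums are eventually constant, whatever \<open>e\<close> is.
\<close>

definition sums_over :: "'i set \<Rightarrow> ('i \<Rightarrow> nat) \<Rightarrow> ('i \<Rightarrow> 'a::real_normed_vector) \<Rightarrow> 'a \<Rightarrow> bool" where
  "sums_over J e g f \<longleftrightarrow> (\<lambda>n. \<Sum>j\<in>{j \<in> J. e j < n}. g j) \<longlonglongrightarrow> f"

text \<open>
  A family indexed by \<open>J\<close> is a function that is \<open>undefined\<close> outside \<open>J\<close>, so that
  uniqueness of the family is uniqueness of the function.
\<close>

definition f_basis ::
  "('k::conj_field \<Rightarrow> 'a::banach \<Rightarrow> 'a) \<Rightarrow> 'i set \<Rightarrow> ('i \<Rightarrow> nat) \<Rightarrow> ('i \<Rightarrow> 'a set) \<Rightarrow> bool" where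
  "f_basis smul J e W \<longleftrightarrow>
     (\<forall>j\<in>J. module.subspace smul (W j) \<and> closed (W j)) \<and>
     (\<forall>f. \<exists>!g. g \<in> (\<Pi>\<^sub>E j\<in>J. W j) \<and> sums_over J e g f)"

definition f_dual ::
  "'i set \<Rightarrow> ('i \<Rightarrow> nat) \<Rightarrow> ('i \<Rightarrow> 'a set) \<Rightarrow> 'i \<Rightarrow> 'a::banach \<Rightarrow> 'a" where
  "f_dual J e W j f = (THE g. g \<in> (\<Pi>\<^sub>E j\<in>J. W j) \<and> sums_over J e g f) j"

definition f_basis_system ::
  "('k::conj_field \<Rightarrow> 'a::banach \<Rightarrow> 'a) \<Rightarrow> 'i set \<Rightarrow> ('i \<Rightarrow> nat) \<Rightarrow> ('i \<Rightarrow> 'a set) \<Rightarrow>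
    ('i \<Rightarrow> 'a \<Rightarrow> 'a) \<Rightarrow> bool" where
  "f_basis_system smul J e W P \<longleftrightarrow> f_basis smul J e W \<and> (\<forall>j\<in>J. P j = f_dual J e W j)"

definition l2_sum :: "'i set \<Rightarrow> ('i \<Rightarrow> 'a::real_normed_vector set) \<Rightarrow> ('i \<Rightarrow> 'a) set" where
  "l2_sum J W = {g \<in> (\<Pi>\<^sub>E j\<in>J. W j). (\<lambda>j. (norm (g j))\<^sup>2) summable_on J}"

definition bessel_f_basis ::
  "('k::conj_field \<Rightarrow> 'a::banach \<Rightarrow> 'a) \<Rightarrow> 'i set \<Rightarrow> ('i \<Rightarrow> nat) \<Rightarrow> ('i \<Rightarrow> 'a set) \<Rightarrow> bool" where
  "bessel_f_basis smul J e W \<longleftrightarrow> f_basis smul J e W \<and>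
     (\<forall>g \<in> (\<Pi>\<^sub>E j\<in>J. W j). (\<exists>f. sums_over J e g f) \<longrightarrow> g \<in> l2_sum J W)"

definition hilbert_f_basis ::
  "('k::conj_field \<Rightarrow> 'a::banach \<Rightarrow> 'a) \<Rightarrow> 'i set \<Rightarrow> ('i \<Rightarrow> nat) \<Rightarrow> ('i \<Rightarrow> 'a set) \<Rightarrow> bool" where
  "hilbert_f_basis smul J e W \<longleftrightarrow> f_basis smul J e W \<and>
     (\<forall>g \<in> l2_sum J W. \<exists>f. sums_over J e g f)"

definition bessel_f_basis_system ::
  "('k::conj_field \<Rightarrow> 'a::banach \<Rightarrow> 'a) \<Rightarrow> 'i set \<Rightarrow> ('i \<Rightarrow> nat) \<Rightarrow> ('i \<Rightarrow> 'a set) \<Rightarrow>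
    ('i \<Rightarrow> 'a \<Rightarrow> 'a) \<Rightarrow> bool" where
  "bessel_f_basis_system smul J e W P \<longleftrightarrow>
     f_basis_system smul J e W P \<and> bessel_f_basis smul J e W"

definition hilbert_f_basis_system ::
  "('k::conj_field \<Rightarrow> 'a::banach \<Rightarrow> 'a) \<Rightarrow> 'i set \<Rightarrow> ('i \<Rightarrow> nat) \<Rightarrow> ('i \<Rightarrow> 'a set) \<Rightarrow>
    ('i \<Rightarrow> 'a \<Rightarrow> 'a) \<Rightarrow> bool" where
  "hilbert_f_basis_system smul J e W P \<longleftrightarrow>
     f_basis_system smul J e W P \<and> hilbert_f_basis smul J e W"

end

theory Submission
  imports Defs
begin

text \<open>
  Both conditions are equivalent to \<open>\<Sum>j. (norm (P j f))\<^sup>2 < \<infinity>\<close> for every \<open>f\<close>. For the Bessel condition this is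
  a reformulation. If it holds, the uniform boundedness principle gives
  \<open>\<Sum>j. (norm (P j f))\<^sup>2 \<le> K\<^sup>2 * (norm f)\<^sup>2\<close>, and by duality the partial sums of a square summable family in the
  spaces \<open>P j\<^sup>* (W j)\<close> are Cauchy. The converse is the self-duality of \<open>\<ell>\<^sup>2\<close> in the form of the Abel--Dini
  theorem. That the adjoints form an f-basis system at all rests on the uniform boundedness of the
  partial sum operators.
\<close>

subsection \<open>Baire category and uniform boundedness\<close>

text \<open>Continuity of the coordinate maps is not part of the definition of an f-basis, so the
  uniform boundedness principle cannot be applied to the partial sums \<open>S n\<close> directly:
  the sets on which they are bounded by a constant are not known to be closed, and Baire yields a
  ball only in a closure. Successive approximation together with uniqueness of expansions bridges
  this gap. Before that, even the adjoint, a definite description, is not known to denote anything.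
  For fixed vectors, boundedness and duality give convergence of the adjoint expansions only in the
  weak sense. Convergence in norm comes from the Hilbert space structure, through orthogonal
  complements. A further tension is that series follow the order given by \<open>e\<close> and may
  converge conditionally, whereas square summability is unordered; nonnegativity reconciles the
  two.\<close>

lemma baire_ball_in_closure:
  fixes A :: "nat \<Rightarrow> 'a::banach set"
  assumes conv: "\<And>n. convex (A n)"
    and sym: "\<And>n x. x \<in> A n \<Longrightarrow> - x \<in> A n"
    and cover: "(\<Union>n. A n) = UNIV"
  obtains n r where "r > 0" "ball 0 r \<subseteq> closure (A n)"
proof -
  have "\<exists>n. interior (closure (A n)) \<noteq> {}"
  proof (rule ccontr)
    assume "\<not> ?thesis"
    then have "euclidean interior_of \<Union>(range (\<lambda>n. closure (A n))) = ({} :: 'a set)"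
      by (intro Baire_category_alt) (auto simp: completely_metrizable_space_euclidean)
    moreover have "\<Union>(range (\<lambda>n. closure (A n))) = UNIV"
    proof -
      have "(\<Union>n. A n) \<subseteq> (\<Union>n. closure (A n))"
        by (intro UN_mono closure_subset) simp
      with cover show ?thesis by blast
    qed
    ultimately show False by simp
  qed
  then obtain n x r where r: "r > 0" "ball x r \<subseteq> closure (A n)"
    by (metis ex_in_conv mem_interior)
  \<comment> \<open>Symmetry and convexity pass to the closure, which moves the ball from
    \<open>x\<close> to \<open>0\<close>: \<open>y\<close> is the midpoint of \<open>x + y\<close>
    and \<open>- (x - y)\<close>.\<close>
  have "uminus ` closure (A n) \<subseteq> closure (A n)"
  proof (rule image_closure_subset)
    show "uminus ` A n \<subseteq> closure (A n)"
      using sym closure_subset[of "A n"] by blast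
  qed (simp_all add: continuous_intros)
  then have symc: "- y \<in> closure (A n)" if "y \<in> closure (A n)" for y
    using that by blast
  have "ball 0 r \<subseteq> closure (A n)"
  proof
    fix y :: 'a
    assume "y \<in> ball 0 r"
    then have "x + y \<in> closure (A n)" "x - y \<in> closure (A n)"
      using r(2) by (auto simp: dist_norm subset_eq)
    then have "(1/2) *\<^sub>R (x + y) + (1/2) *\<^sub>R (- (x - y)) \<in> closure (A n)"
      using convex_closure[OF conv, of n] symc[of "x - y"] by (intro convexD) (simp_all del: minus_diff_eq)
    moreover have "(1/2) *\<^sub>R (x + y) + (1/2) *\<^sub>R (- (x - y)) = y"
      by (simp add: scaleR_right_diff_distrib scaleR_right_distrib flip: scaleR_left.add)
    ultimately show "y \<in> closure (A n)" by simp
  qed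
  with r(1) that show thesis by blast
qed

text \<open>Continuity makes the sets \<open>A n\<close> closed, so here the ball given by Baire
  lies in \<open>A n\<close> itself. The intended seminorms are the Euclidean norms of finitely many
  coordinates.\<close>

lemma seminorms_uniformly_bounded:
  fixes p :: "'i \<Rightarrow> 'a::banach \<Rightarrow> real"
  assumes cont: "\<And>i. i \<in> I \<Longrightarrow> continuous_on UNIV (p i)"
    and sub: "\<And>i x y. i \<in> I \<Longrightarrow> p i (x + y) \<le> p i x + p i y"
    and hom: "\<And>i c x. i \<in> I \<Longrightarrow> p i (c *\<^sub>R x) = \<bar>c\<bar> * p i x"
    and bdd: "\<And>x. \<exists>B. \<forall>i\<in>I. p i x \<le> B"
  obtains K where "K \<ge> 0" "\<And>i x. i \<in> I \<Longrightarrow> p i x \<le> K * norm x"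
proof -
  define A where "A n = {x. \<forall>i\<in>I. p i x \<le> real n}" for n
  have conv: "convex (A n)" for n
    unfolding convex_def
  proof (intro ballI allI impI)
    fix x y :: 'a and u v :: real
    assume xy: "x \<in> A n" "y \<in> A n" and uv: "0 \<le> u" "0 \<le> v" "u + v = 1"
    have "p i (u *\<^sub>R x + v *\<^sub>R y) \<le> real n" if i: "i \<in> I" for i
    proof -
      have "p i (u *\<^sub>R x + v *\<^sub>R y) \<le> u * p i x + v * p i y"
        using sub[OF i, of "u *\<^sub>R x" "v *\<^sub>R y"] uv by (simp add: hom[OF i])
      also have "\<dots> \<le> u * real n + v * real n"
        using xy i uv by (intro add_mono mult_left_mono) (auto simp: A_def)
      also have "\<dots> = real n"
        using uv by (simp flip: distrib_right)
      finally show ?thesis .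
    qed
    then show "u *\<^sub>R x + v *\<^sub>R y \<in> A n"
      by (simp add: A_def)
  qed
  have sym: "- x \<in> A n" if "x \<in> A n" for n x
    using that hom[of _ "-1" x] by (simp add: A_def)
  have "x \<in> (\<Union>n. A n)" for x
  proof -
    obtain B where "\<forall>i\<in>I. p i x \<le> B" using bdd by blast
    moreover obtain n where "B \<le> real n" using real_arch_simple by blast
    ultimately have "x \<in> A n" by (force simp: A_def)
    then show ?thesis by blast
  qed
  then have "(\<Union>n. A n) = UNIV" by blast
  then obtain n r where r: "r > 0" and ball: "ball 0 r \<subseteq> closure (A n)"
    using baire_ball_in_closure[of A, OF conv sym] by blast
  have "A n = (\<Inter>i\<in>I. {x. p i x \<le> real n})"
    by (auto simp: A_def)
  then have "closed (A n)"
    by (simp add: closed_INT closed_Collect_le cont)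
  then have ball: "ball 0 r \<subseteq> A n"
    using ball by simp
  have "p i x \<le> (2 * real n / r) * norm x" if i: "i \<in> I" for i x
  proof (cases "x = 0")
    case True
    then show ?thesis using hom[OF i, of 0 x] by simp
  next
    case False
    \<comment> \<open>Scaling to norm \<open>r / 2\<close> stays strictly inside the open ball; this
      is the origin of the factor 2 in the bound.\<close>
    define c where "c = r / (2 * norm x)"
    have c: "c > 0" using False r by (simp add: c_def)
    have "c *\<^sub>R x \<in> ball 0 r"
      using False r by (simp add: c_def)
    then have "c *\<^sub>R x \<in> A n"
      using ball by blast
    then have "p i (c *\<^sub>R x) \<le> real n"
      using i by (simp add: A_def)
    then have "c * p i x \<le> real n"
      using hom[OF i] c by simp
    then show ?thesis
      using False r by (simp add: c_def field_simps)
  qed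
  moreover have "2 * real n / r \<ge> 0" using r by simp
  ultimately show thesis using that by blast
qed

subsection \<open>Hilbert spaces over a conjugation field\<close>

lemma conj_of_real' [simp]: "conj (of_real r) = (of_real r :: 'k::conj_field)"
  by (simp add: of_real_def conj_of_real)

lemma conj_zero [simp]: "conj (0::'k::conj_field) = 0"
  using conj_of_real'[of 0] by simp

lemma conj_minus [simp]: "conj (- x) = - conj (x::'k::conj_field)"
  using conj_add[of x "- x"] by (simp add: eq_neg_iff_add_eq_0 add.commute)

lemma mult_conj': "x * conj x = of_real ((norm (x::'k::conj_field))\<^sup>2)"
  by (simp add: of_real_def mult_conj)

lemma norm_conj [simp]: "norm (conj x) = norm (x::'k::conj_field)"
proof (cases "x = 0")
  case False
  have "norm x * norm (conj x) = norm x * norm x"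
    using arg_cong[OF mult_conj'[of x], of norm] by (simp add: norm_mult power2_eq_square)
  then show ?thesis using False by simp
qed simp

text \<open>Multiplied by \<open>conj x\<close>, both sides equal the squared norm of
  \<open>x\<close>, because \<open>conj\<close> is isometric.\<close>

lemma conj_conj [simp]: "conj (conj x) = (x::'k::conj_field)"
proof (cases "x = 0")
  case False
  then have "conj x \<noteq> 0" using norm_conj[of x] by (metis norm_eq_zero)
  moreover have "conj x * conj (conj x) = conj x * x"
    using mult_conj'[of x] mult_conj'[of "conj x"] by (simp add: mult.commute)
  ultimately show ?thesis by simp
qed simp

context separable_hilbert_space
begin

lemma ip_zero_left [simp]: "ip 0 z = 0"
  using ip_add[of 0 0 z] by simp

lemma ip_zero_right [simp]: "ip z 0 = 0"
  using ip_conj[of z 0] by simp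

lemma ip_minus_left: "ip (- x) z = - ip x z"
  using ip_add[of x "- x" z] by (simp add: eq_neg_iff_add_eq_0 add.commute)

lemma ip_diff_left: "ip (x - y) z = ip x z - ip y z"
  using ip_add[of x "- y" z] by (simp add: ip_minus_left)

lemma ip_add_right: "ip z (x + y) = ip z x + ip z y"
  by (metis ip_conj ip_add conj_add)

lemma ip_minus_right: "ip z (- x) = - ip z x"
  by (metis ip_conj ip_minus_left conj_minus)

lemma ip_diff_right: "ip z (x - y) = ip z x - ip z y"
  using ip_add_right[of z x "- y"] by (simp add: ip_minus_right)

lemma ip_smul_right: "ip x (smul c y) = conj c * ip x y"
  by (metis ip_conj ip_smul conj_mult)

lemma ip_scaleR_left: "ip (r *\<^sub>R x) y = of_real r * ip x y"
  using ip_smul[of "of_real r" x y] by (simp add: smul_of_real)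

lemma ip_sum_left: "ip (sum f A) z = (\<Sum>i\<in>A. ip (f i) z)"
  by (induction A rule: infinite_finite_induct) (simp_all add: ip_add)

lemma ip_sum_right: "ip z (sum f A) = (\<Sum>i\<in>A. ip z (f i))"
  by (induction A rule: infinite_finite_induct) (simp_all add: ip_add_right)

lemma ip_self_eq_0 [simp]: "ip x x = 0 \<longleftrightarrow> x = 0"
  by (simp add: ip_norm)

lemma ip_eq_0_commute: "ip x y = 0 \<longleftrightarrow> ip y x = 0"
  by (metis ip_conj conj_zero)

lemma ip_left_cancel: "(\<And>x. ip x y = ip x z) \<Longrightarrow> y = z"
  by (metis eq_iff_diff_eq_0 ip_diff_right ip_self_eq_0)

lemma norm_smul [simp]: "norm (smul c x) = norm c * norm x"
proof -
  have "(of_real ((norm (smul c x))\<^sup>2) :: 'k) = (c * conj c) * ip x x"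
    by (simp only: ip_smul ip_smul_right mult_ac flip: ip_norm)
  also have "\<dots> = of_real ((norm c)\<^sup>2 * (norm x)\<^sup>2)"
    by (simp only: mult_conj' ip_norm of_real_mult)
  finally have "(of_real ((norm (smul c x))\<^sup>2) :: 'k) = of_real ((norm c)\<^sup>2 * (norm x)\<^sup>2)" .
  then have "(norm (smul c x))\<^sup>2 = (norm c * norm x)\<^sup>2"
    unfolding of_real_eq_iff by (simp add: power_mult_distrib)
  then show ?thesis by (simp add: power2_eq_iff_nonneg)
qed

lemma pythagoras:
  assumes "ip x y = 0"
  shows "(norm (x + y))\<^sup>2 = (norm x)\<^sup>2 + (norm y)\<^sup>2"
proof -
  have "of_real ((norm (x + y))\<^sup>2) = (of_real ((norm x)\<^sup>2 + (norm y)\<^sup>2) :: 'k)"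
    using assms ip_eq_0_commute[of x y]
    by (simp add: ip_add ip_add_right flip: ip_norm del: of_real_power)
  then show ?thesis unfolding of_real_eq_iff .
qed

lemma parallelogram:
  fixes x y :: 'a
  shows "(norm (x + y))\<^sup>2 + (norm (x - y))\<^sup>2 = 2 * (norm x)\<^sup>2 + 2 * (norm y)\<^sup>2"
proof -
  have "(of_real ((norm (x + y))\<^sup>2 + (norm (x - y))\<^sup>2) :: 'k)
      = of_real (((norm x)\<^sup>2 + (norm x)\<^sup>2) + ((norm y)\<^sup>2 + (norm y)\<^sup>2))"
    unfolding of_real_add ip_norm[symmetric]
    by (simp add: ip_add ip_add_right ip_diff_left ip_diff_right)
  then show ?thesis unfolding of_real_eq_iff by simp
qed

text \<open>Pythagoras, applied to the component of \<open>x\<close> along \<open>y\<close> and the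
  residual, gives the second claim; nonnegativity of the residual norm is then Cauchy-Schwarz. The
  exact formula is what later shows that a nearest point is an orthogonal projection.\<close>

lemma norm_ip_le: "norm (ip x y) \<le> norm x * norm y"
  and norm_residual:
    "y \<noteq> 0 \<Longrightarrow> (norm (x - smul (ip x y / ip y y) y))\<^sup>2 = (norm x)\<^sup>2 - (norm (ip x y))\<^sup>2 / (norm y)\<^sup>2"
proof -
  define c where "c = ip x y / ip y y"
  define z where "z = x - smul (ip x y / ip y y) y"
  have res: "(norm z)\<^sup>2 = (norm x)\<^sup>2 - (norm (ip x y))\<^sup>2 / (norm y)\<^sup>2" if "y \<noteq> 0"
  proof -
    have "ip z (smul (ip x y / ip y y) y) = 0"
      using that by (simp add: z_def ip_smul ip_smul_right ip_diff_left)
    from pythagoras[OF this]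
    have "(norm x)\<^sup>2 = (norm z)\<^sup>2 + (norm c * norm y)\<^sup>2"
      by (simp add: z_def c_def)
    moreover have "norm c = norm (ip x y) / (norm y)\<^sup>2"
      by (simp add: c_def norm_divide ip_norm norm_power)
    ultimately show ?thesis
      using that by (simp add: power2_eq_square)
  qed
  then show "y \<noteq> 0 \<Longrightarrow> (norm (x - smul (ip x y / ip y y) y))\<^sup>2 = (norm x)\<^sup>2 - (norm (ip x y))\<^sup>2 / (norm y)\<^sup>2"
    by (simp add: z_def)
  show "norm (ip x y) \<le> norm x * norm y"
  proof (cases "y = 0")
    case False
    have "(norm x)\<^sup>2 - (norm (ip x y))\<^sup>2 / (norm y)\<^sup>2 \<ge> 0"
      using res[OF False] by (metis zero_le_power2)
    then have "(norm (ip x y))\<^sup>2 \<le> (norm x * norm y)\<^sup>2"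
      using False by (simp add: field_simps power_mult_distrib)
    then show ?thesis by (simp add: power2_le_iff_abs_le)
  qed simp
qed

lemma bounded_linear_ip_left: "bounded_linear (\<lambda>x. ip x y)"
  by (rule bounded_linear_intro[of _ "norm y"])
    (simp_all add: ip_add ip_scaleR_left norm_ip_le scaleR_conv_of_real)

lemma norm_le_if_ip_le:
  assumes "\<And>y. norm (ip x y) \<le> B * norm y" "B \<ge> 0"
  shows "norm x \<le> B"
  using assms(1)[of x] assms(2) by (cases "x = 0") (simp_all add: ip_norm power2_eq_square norm_mult)

end

section \<open>Orthogonal projections, Riesz representation and adjoints\<close>

context separable_hilbert_space
begin

lemma subspace_scaleR: "subspace M \<Longrightarrow> x \<in> M \<Longrightarrow> r *\<^sub>R x \<in> M"
  by (metis smul_of_real subspace_scale)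

lemma orthogonal_projection:
  assumes M: "subspace M" "closed M"
  obtains m where "m \<in> M" "\<And>y. y \<in> M \<Longrightarrow> ip (x - m) y = 0"
proof -
  define d where "d = (INF m\<in>M. (norm (x - m))\<^sup>2)"
  have d_le: "d \<le> (norm (x - m))\<^sup>2" if "m \<in> M" for m
    unfolding d_def using that by (intro cINF_lower bdd_belowI2[where m=0]) auto
  have "\<exists>m\<in>M. (norm (x - m))\<^sup>2 < d + 1 / real (Suc n)" for n
  proof -
    have "M \<noteq> {}" using subspace_0[OF M(1)] by blast
    moreover have "bdd_below ((\<lambda>m. (norm (x - m))\<^sup>2) ` M)"
      by (intro bdd_belowI2[where m=0]) auto
    moreover have "(INF m\<in>M. (norm (x - m))\<^sup>2) < d + 1 / real (Suc n)"
      by (simp add: d_def)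
    ultimately show ?thesis
      using cINF_less_iff[of M "\<lambda>m. (norm (x - m))\<^sup>2"] by blast
  qed
  then obtain s where s: "\<And>n. s n \<in> M" "\<And>n. (norm (x - s n))\<^sup>2 < d + 1 / real (Suc n)"
    by metis
  \<comment> \<open>The midpoint of \<open>a\<close> and \<open>b\<close> lies in \<open>M\<close>,
    so its squared distance from \<open>x\<close> is at least \<open>d\<close>; the parallelogram
    law turns this into a Cauchy estimate for minimising sequences.\<close>
  have gap: "(norm (a - b))\<^sup>2 \<le> 2 * ((norm (x - a))\<^sup>2 - d) + 2 * ((norm (x - b))\<^sup>2 - d)"
    if ab: "a \<in> M" "b \<in> M" for a b
  proof -
    have "(1/2) *\<^sub>R (a + b) \<in> M"
      using M(1) ab by (intro subspace_scaleR subspace_add)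
    note d_le[OF this]
    moreover have "(x - a) + (x - b) = 2 *\<^sub>R (x - (1/2) *\<^sub>R (a + b))"
      by (simp add: scaleR_right_diff_distrib scaleR_2)
    then have "(norm ((x - a) + (x - b)))\<^sup>2 = 4 * (norm (x - (1/2) *\<^sub>R (a + b)))\<^sup>2"
      by (simp add: power_mult_distrib)
    moreover have "(x - a) - (x - b) = b - a" by simp
    ultimately show ?thesis
      using parallelogram[of "x - a" "x - b"] by (simp add: norm_minus_commute)
  qed
  have "Cauchy s"
  proof (rule metric_CauchyI)
    fix \<epsilon> :: real
    assume "\<epsilon> > 0"
    then obtain N where N: "1 / real (Suc N) < \<epsilon>\<^sup>2 / 4"
      using reals_Archimedean[of "\<epsilon>\<^sup>2 / 4"] by (auto simp: inverse_eq_divide)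
    have "dist (s p) (s q) < \<epsilon>" if "p \<ge> N" "q \<ge> N" for p q
    proof -
      have "1 / real (Suc p) \<le> 1 / real (Suc N)" "1 / real (Suc q) \<le> 1 / real (Suc N)"
        using that by (simp_all add: frac_le)
      then have "(norm (s p - s q))\<^sup>2 < \<epsilon>\<^sup>2"
        using gap[OF s(1)[of p] s(1)[of q]] s(2)[of p] s(2)[of q] N by argo
      then show ?thesis
        using \<open>\<epsilon> > 0\<close> by (simp add: dist_norm power_less_imp_less_base)
    qed
    then show "\<exists>N. \<forall>p\<ge>N. \<forall>q\<ge>N. dist (s p) (s q) < \<epsilon>" by blast
  qed
  then obtain m where m: "s \<longlonglongrightarrow> m"
    using Cauchy_convergent_iff convergent_def by blast
  have "m \<in> M"
    using closed_sequentially[OF M(2)] s(1) m by blast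
  have "(norm (x - m))\<^sup>2 \<le> d + 0"
  proof (rule LIMSEQ_le)
    show "(\<lambda>n. (norm (x - s n))\<^sup>2) \<longlonglongrightarrow> (norm (x - m))\<^sup>2"
      by (intro tendsto_intros m)
    show "(\<lambda>n. d + 1 / real (Suc n)) \<longlonglongrightarrow> d + 0"
      using LIMSEQ_inverse_real_of_nat by (intro tendsto_intros) (simp add: inverse_eq_divide)
  qed (use s(2) less_imp_le in blast)
  then have min: "(norm (x - m))\<^sup>2 \<le> d" by simp
  have "ip (x - m) y = 0" if y: "y \<in> M" for y
  proof (cases "y = 0")
    case False
    \<comment> \<open>Moving from \<open>m\<close> by this multiple of \<open>y\<close> lowers the
      squared distance by exactly the term that has to vanish.\<close>
    define c where "c = ip (x - m) y / ip y y"
    have "m + smul c y \<in> M"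
      using M(1) \<open>m \<in> M\<close> y by (intro subspace_add subspace_scale)
    then have "d \<le> (norm (x - m - smul c y))\<^sup>2"
      using d_le by (simp add: diff_diff_eq)
    also have "\<dots> = (norm (x - m))\<^sup>2 - (norm (ip (x - m) y))\<^sup>2 / (norm y)\<^sup>2"
      unfolding c_def by (rule norm_residual[OF False])
    finally have "(norm (ip (x - m) y))\<^sup>2 / (norm y)\<^sup>2 \<le> 0"
      using min by simp
    then show ?thesis
      using False by (simp add: divide_le_0_iff)
  qed simp
  with \<open>m \<in> M\<close> that show thesis by blast
qed

lemma subspace_UNIV_if_orthogonal_trivial:
  assumes "subspace M" "closed M" and triv: "\<And>z. (\<And>y. y \<in> M \<Longrightarrow> ip z y = 0) \<Longrightarrow> z = 0"
  shows "M = UNIV"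
proof -
  have "x \<in> M" for x
    using orthogonal_projection[OF assms(1,2), of x] triv by (metis eq_iff_diff_eq_0)
  then show ?thesis by blast
qed

text \<open>A vector \<open>z\<close> orthogonal to the closed kernel and outside it determines the
  functional, since \<open>x\<close> minus a multiple of \<open>z\<close> lies in the kernel. The
  coefficient is conjugated because \<open>ip\<close> is conjugate-linear in its second
  argument.\<close>

lemma riesz_representation:
  assumes add: "\<And>x y. \<phi> (x + y) = \<phi> x + \<phi> y"
    and scale: "\<And>c x. \<phi> (smul c x) = c * \<phi> x"
    and bound: "\<And>x. norm (\<phi> x) \<le> B * norm x"
  shows "\<exists>y. \<forall>x. \<phi> x = ip x y"
proof (cases "\<exists>u. \<phi> u \<noteq> 0")
  case False
  then show ?thesis by (intro exI[of _ 0]) simp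
next
  case True
  then obtain u where u: "\<phi> u \<noteq> 0" by blast
  have bl: "bounded_linear \<phi>"
    using bound scale[of "of_real _"]
    by (intro bounded_linear_intro[of _ B])
      (simp_all add: add smul_of_real scaleR_conv_of_real mult.commute)
  have "closed {x. \<phi> x = 0}"
    by (intro closed_Collect_eq linear_continuous_on bl continuous_on_const)
  moreover have zero: "\<phi> 0 = 0" using scale[of 0 0] by simp
  then have "subspace {x. \<phi> x = 0}"
    by (intro subspaceI) (simp_all add: add scale)
  ultimately obtain m where m: "\<phi> m = 0" "\<And>y. \<phi> y = 0 \<Longrightarrow> ip (u - m) y = 0"
    using orthogonal_projection[of "{x. \<phi> x = 0}" u] by auto
  define z where "z = u - m"
  have diff: "\<phi> (x - y) = \<phi> x - \<phi> y" for x y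
    using bl by (rule linear_diff[OF bounded_linear.linear])
  have z: "\<phi> z \<noteq> 0" "z \<noteq> 0"
    using u m(1) zero by (auto simp: z_def diff)
  have "\<phi> x = ip x (smul (conj (\<phi> z / ip z z)) z)" for x
  proof -
    have "\<phi> (x - smul (\<phi> x / \<phi> z) z) = 0"
      using z by (simp add: diff scale)
    then have "ip (x - smul (\<phi> x / \<phi> z) z) z = 0"
      using m(2) ip_eq_0_commute unfolding z_def by blast
    then have "ip x z = \<phi> x / \<phi> z * ip z z"
      by (simp add: ip_diff_left ip_smul)
    then show ?thesis
      using z by (simp add: ip_smul_right)
  qed
  then show ?thesis by blast
qed

text \<open>Riesz supplies a map with the defining property of the adjoint and nondegeneracy of
  \<open>ip\<close> makes it unique, so the definite description denotes it.\<close>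

lemma ip_hilbert_adjoint:
  assumes add: "\<And>x y. T (x + y) = T x + T y"
    and scale: "\<And>c x. T (smul c x) = smul c (T x)"
    and bound: "\<And>x. norm (T x) \<le> B * norm x"
  shows "ip (T x) y = ip x (hilbert_adjoint ip T y)"
proof -
  have "\<exists>z. \<forall>x. ip (T x) y = ip x z" for y
  proof (rule riesz_representation)
    fix x
    have "norm (ip (T x) y) \<le> norm (T x) * norm y" by (rule norm_ip_le)
    also have "\<dots> \<le> (B * norm x) * norm y" by (intro mult_right_mono bound) simp
    finally show "norm (ip (T x) y) \<le> (B * norm y) * norm x" by (simp add: mult_ac)
  qed (simp_all add: add scale ip_add ip_smul)
  then obtain S where S: "\<forall>x y. ip (T x) y = ip x (S y)" by metis
  moreover have "S' = S" if "\<forall>x y. ip (T x) y = ip x (S' y)" for S'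
    using that S ip_left_cancel by (metis ext)
  ultimately have "hilbert_adjoint ip T = S"
    unfolding hilbert_adjoint_def by (intro the_equality)
  with S show ?thesis by simp
qed

end

subsection \<open>Divergent series and sums over initial segments\<close>

text \<open>With \<open>s\<close> the partial sums of the squares, the witness is
  \<open>b n / s (Suc n)\<close>. Its squares are dominated by the telescoping differences
  \<open>1 / s n - 1 / s (Suc n)\<close>, while a block of the product series from \<open>p\<close>
  to \<open>q\<close> is at least \<open>(s q - s p) / s q\<close>, which exceeds one half once
  \<open>s q > 2 * s p\<close>. The last conclusion keeps \<open>a\<close> supported where
  \<open>b\<close> is, so that it can be carried back to the index set.\<close>

lemma abel_dini:
  fixes b :: "nat \<Rightarrow> real"
  assumes "\<not> summable (\<lambda>n. (b n)\<^sup>2)"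
  obtains a where "summable (\<lambda>n. (a n)\<^sup>2)" "\<not> summable (\<lambda>n. a n * b n)" "\<And>n. b n = 0 \<Longrightarrow> a n = 0"
proof -
  define s where "s n = (\<Sum>k<n. (b k)\<^sup>2)" for n
  have s_Suc: "s (Suc n) = s n + (b n)\<^sup>2" for n
    by (simp add: s_def)
  have mono: "s m \<le> s n" if "m \<le> n" for m n
    using that by (simp add: s_def sum_mono2)
  have unb: "\<exists>n>m. s n > c" for c m
  proof (rule ccontr)
    assume "\<not> ?thesis"
    then have "s n \<le> c" if "n > m" for n
      using that not_le by blast
    then have "s n \<le> c" for n
      using mono[of n "max n (Suc m)"] by (meson le_trans less_le_trans lessI max.cobounded1 max.cobounded2 order_trans)
    then have "summable (\<lambda>n. (b n)\<^sup>2)"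
      by (intro bounded_imp_summable[of _ c]) (auto simp: s_def lessThan_Suc_atMost[symmetric] simp del: sum.lessThan_Suc)
    with assms show False by simp
  qed
  \<comment> \<open>Leading zeros of \<open>b\<close> would put zero denominators into the
    telescoping sum, so the estimates start at \<open>m\<close>.\<close>
  obtain m where m: "s m > 0" using unb[of _ 0] by blast
  then have pos: "s n > 0" if "n \<ge> m" for n using mono[OF that] by simp
  define a where "a n = b n / s (Suc n)" for n
  have sq: "(a n)\<^sup>2 \<le> 1 / s n - 1 / s (Suc n)" if n: "n \<ge> m" for n
  proof -
    have p: "s n > 0" "s (Suc n) > 0" using n pos by simp_all
    have "(a n)\<^sup>2 = (b n)\<^sup>2 / (s (Suc n) * s (Suc n))"
      by (simp add: a_def power2_eq_square)
    also have "\<dots> \<le> (b n)\<^sup>2 / (s n * s (Suc n))"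
      using p mono[of n "Suc n"] by (intro divide_left_mono mult_right_mono mult_pos_pos) simp_all
    also have "\<dots> = 1 / s n - 1 / s (Suc n)"
      using p by (simp add: s_Suc divide_simps)
    finally show ?thesis .
  qed
  have "(\<Sum>k\<le>n. (a (k + m))\<^sup>2) \<le> 1 / s m - 1 / s (n + m + 1)" for n
  proof (induction n)
    case 0
    then show ?case using sq[of m] by simp
  next
    case (Suc n)
    then show ?case using sq[of "Suc n + m"] by simp
  qed
  moreover have "1 / s m - 1 / s (n + m + 1) \<le> 1 / s m" for n
    using pos[of "n + m + 1"] by simp
  ultimately have "summable (\<lambda>k. (a (k + m))\<^sup>2)"
    by (intro bounded_imp_summable[of _ "1 / s m"]) (simp, meson order_trans)
  then have 1: "summable (\<lambda>k. (a k)\<^sup>2)"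
    by (subst (asm) summable_iff_shift)
  have 2: "\<not> summable (\<lambda>n. a n * b n)"
  proof
    assume "summable (\<lambda>n. a n * b n)"
    then obtain N where N: "\<And>p q. p \<ge> N \<Longrightarrow> norm (sum (\<lambda>n. a n * b n) {p..<q}) < 1/2"
      unfolding summable_Cauchy by (metis half_gt_zero_iff zero_less_one)
    define p where "p = max N m"
    obtain q where q: "q > p" "s q > 2 * s p" using unb by blast
    have sp: "s p > 0" using pos by (simp add: p_def)
    then have sq: "s q > 0" using q by simp
    have "(s q - s p) / s q = (\<Sum>n=p..<q. (b n)\<^sup>2 / s q)"
    proof -
      have "s q - s p = (\<Sum>n=p..<q. (b n)\<^sup>2)"
        using q(1) sum_diff_nat_ivl[of 0 p q "\<lambda>n. (b n)\<^sup>2"] by (simp add: s_def atLeast0LessThan)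
      then show ?thesis by (simp add: sum_divide_distrib)
    qed
    also have "\<dots> \<le> (\<Sum>n=p..<q. a n * b n)"
    proof (rule sum_mono)
      fix n assume n: "n \<in> {p..<q}"
      then have "s (Suc n) \<le> s q" "s (Suc n) > 0"
        using mono pos by (simp_all add: p_def)
      then show "(b n)\<^sup>2 / s q \<le> a n * b n"
        using sq by (simp add: a_def power2_eq_square frac_le)
    qed
    also have "\<dots> < 1/2"
      using N[of p q] by (simp add: p_def abs_less_iff)
    finally have "s q - s p < s q / 2"
      using sq by (simp add: field_simps)
    with q(2) show False by simp
  qed
  show thesis
    using that[OF 1 2] by (simp add: a_def)
qed

section \<open>Series over an enumerated index set\<close>

lemma finite_initial_segment:
  assumes "inj_on e J"
  shows "finite {j \<in> J. e j < (n::nat)}"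
  using assms by (intro inj_on_finite[of e _ "{..<n}"]) (auto intro: inj_on_subset)

lemma finite_subset_initial_segment:
  assumes "finite F" "F \<subseteq> J"
  obtains n where "F \<subseteq> {j \<in> J. e j < (n::nat)}"
proof -
  have "F \<subseteq> {j \<in> J. e j < Suc (Max (e ` F))}"
    using assms by (auto simp: less_Suc_eq_le)
  with that show thesis by blast
qed

text \<open>Extending a family by zero at the naturals that \<open>e\<close> misses turns its
  ordered partial sums into those of a sequence, to which \<open>abel_dini\<close> applies.\<close>

lemma sum_initial_segment:
  fixes b :: "'i \<Rightarrow> 'v::comm_monoid_add"
  assumes "inj_on e J"
  shows "(\<Sum>k<n::nat. if k \<in> e ` J then b (the_inv_into J e k) else 0) = (\<Sum>j\<in>{j \<in> J. e j < n}. b j)"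
proof -
  have "(\<Sum>k<n. if k \<in> e ` J then b (the_inv_into J e k) else 0)
      = (\<Sum>k\<in>{k \<in> {..<n}. k \<in> e ` J}. b (the_inv_into J e k))"
    by (rule sum.inter_filter[symmetric]) simp
  also have "{k \<in> {..<n}. k \<in> e ` J} = e ` {j \<in> J. e j < n}"
    by auto
  also have "(\<Sum>k\<in>e ` {j \<in> J. e j < n}. b (the_inv_into J e k)) = (\<Sum>j\<in>{j \<in> J. e j < n}. b j)"
    using assms by (subst sum.reindex) (auto simp: the_inv_into_f_f intro: inj_on_subset)
  finally show ?thesis .
qed

lemma sums_over_cong:
  assumes "\<And>j. j \<in> J \<Longrightarrow> g j = h j"
  shows "sums_over J e g f \<longleftrightarrow> sums_over J e h f"
proof -
  have "(\<Sum>j\<in>{j \<in> J. e j < n}. g j) = (\<Sum>j\<in>{j \<in> J. e j < n}. h j)" for n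
    using assms by (intro sum.cong) auto
  then show ?thesis by (simp add: sums_over_def)
qed

lemma sums_over_add:
  "sums_over J e g x \<Longrightarrow> sums_over J e h y \<Longrightarrow> sums_over J e (\<lambda>j. g j + h j) (x + y)"
  unfolding sums_over_def by (simp add: sum.distrib tendsto_add)

lemma sums_over_bounded_linear:
  assumes "bounded_linear T" "sums_over J e g x"
  shows "sums_over J e (\<lambda>j. T (g j)) (T x)"
  using bounded_linear.tendsto[OF assms(1) assms(2)[unfolded sums_over_def]]
  by (simp add: sums_over_def linear_sum[OF bounded_linear.linear[OF assms(1)]])

lemma sums_over_single:
  assumes "inj_on e J" "k \<in> J"
  shows "sums_over J e (\<lambda>j. if j = k then w else 0) w"
  unfolding sums_over_def
proof (rule tendsto_eventually, rule eventually_sequentiallyI[of "Suc (e k)"])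
  fix n assume "Suc (e k) \<le> n"
  then show "(\<Sum>j\<in>{j \<in> J. e j < n}. if j = k then w else 0) = w"
    using assms by (simp add: sum.delta finite_initial_segment)
qed

lemma sums_over_unique: "sums_over J e g x \<Longrightarrow> sums_over J e g y \<Longrightarrow> x = y"
  unfolding sums_over_def by (rule LIMSEQ_unique)

text \<open>Every finite subset of \<open>J\<close> lies in an initial segment, so for nonnegative
  terms the bound extends from ordered to unordered sums.\<close>

lemma summable_on_if_initial_sums_bounded:
  fixes b :: "'i \<Rightarrow> real"
  assumes "inj_on e J" "\<And>j. j \<in> J \<Longrightarrow> b j \<ge> 0"
    and bound: "\<And>n. (\<Sum>j\<in>{j \<in> J. e j < (n::nat)}. b j) \<le> B"
  shows "b summable_on J"
proof (rule nonneg_bdd_above_summable_on)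
  show "bdd_above (sum b ` {F. F \<subseteq> J \<and> finite F})"
  proof (rule bdd_aboveI2)
    fix F assume F: "F \<in> {F. F \<subseteq> J \<and> finite F}"
    then obtain n where n: "F \<subseteq> {j \<in> J. e j < n}"
      using finite_subset_initial_segment[of F J e] by blast
    have "sum b F \<le> (\<Sum>j\<in>{j \<in> J. e j < n}. b j)"
      using assms(2) n by (intro sum_mono2 finite_initial_segment assms(1)) auto
    with bound[of n] show "sum b F \<le> B" by linarith
  qed
qed (use assms(2) in blast)

lemma (in separable_hilbert_space) bounded_linearI:
  assumes "\<And>x y. T (x + y) = T x + T y" "\<And>c x. T (smul c x) = smul c (T x)"
    "\<And>x. norm (T x) \<le> B * norm x"
  shows "bounded_linear T"
  using assms by (intro bounded_linear_intro[of _ B]) (simp_all add: mult.commute flip: smul_of_real)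

lemma (in separable_hilbert_space) bounded_linear_smul: "bounded_linear (smul c)"
  by (rule bounded_linearI[of _ "norm c"]) (simp_all add: scale_right_distrib mult.commute)

subsection \<open>Partial sum operators of an f-basis\<close>

locale fusion_basis = separable_hilbert_space smul ip
  for smul :: "'k::conj_field \<Rightarrow> 'a::banach \<Rightarrow> 'a" and ip :: "'a \<Rightarrow> 'a \<Rightarrow> 'k" +
  fixes J :: "'i set" and e :: "'i \<Rightarrow> nat" and W :: "'i \<Rightarrow> 'a set"
  assumes inj_e: "inj_on e J" and basis: "f_basis smul J e W"
begin

abbreviation "P \<equiv> f_dual J e W"

definition "S n x = (\<Sum>j\<in>{j \<in> J. e j < n}. P j x)"

lemma W_subspace: "j \<in> J \<Longrightarrow> subspace (W j)" and W_closed: "j \<in> J \<Longrightarrow> closed (W j)"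
  using basis by (simp_all add: f_basis_def)

text \<open>The source of all algebraic properties of \<open>P\<close>: each follows by exhibiting
  an expansion. Restricting \<open>g\<close> to \<open>J\<close> provides the extensionality that
  uniqueness of the family demands.\<close>

lemma P_unique:
  assumes "\<And>j. j \<in> J \<Longrightarrow> g j \<in> W j" "sums_over J e g x" "j \<in> J"
  shows "P j x = g j"
proof -
  have "restrict g J \<in> (\<Pi>\<^sub>E j\<in>J. W j) \<and> sums_over J e (restrict g J) x"
    using assms(1,2) sums_over_cong[of J "restrict g J" g e x] by auto
  moreover have "\<exists>!g. g \<in> (\<Pi>\<^sub>E j\<in>J. W j) \<and> sums_over J e g x"
    using basis by (simp add: f_basis_def)
  ultimately have "(THE g. g \<in> (\<Pi>\<^sub>E j\<in>J. W j) \<and> sums_over J e g x) = restrict g J"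
    by (intro the1_equality)
  with assms(3) show ?thesis by (simp add: f_dual_def)
qed

lemma P_in: "j \<in> J \<Longrightarrow> P j x \<in> W j" and sums_over_P: "sums_over J e (\<lambda>j. P j x) x"
proof -
  obtain g where g: "g \<in> (\<Pi>\<^sub>E j\<in>J. W j)" "sums_over J e g x"
    using basis unfolding f_basis_def by (meson ex1_implies_ex)
  then have eq: "P j x = g j" if "j \<in> J" for j
    using that by (intro P_unique) auto
  show "j \<in> J \<Longrightarrow> P j x \<in> W j" using eq g(1) by auto
  show "sums_over J e (\<lambda>j. P j x) x"
    using g(2) sums_over_cong[of J "\<lambda>j. P j x" g] eq by blast
qed

lemma S_tendsto: "(\<lambda>n. S n x) \<longlonglongrightarrow> x"
  using sums_over_P[of x] by (simp add: sums_over_def S_def)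

lemma P_add: "j \<in> J \<Longrightarrow> P j (x + y) = P j x + P j y"
  by (rule P_unique[where g = "\<lambda>j. P j x + P j y"])
    (simp_all add: subspace_add W_subspace P_in sums_over_add sums_over_P)

lemma P_smul: "j \<in> J \<Longrightarrow> P j (smul c x) = smul c (P j x)"
  by (rule P_unique[where g = "\<lambda>j. smul c (P j x)"])
    (simp_all add: subspace_scale W_subspace P_in
      sums_over_bounded_linear[OF bounded_linear_smul] sums_over_P)

lemma P_scaleR: "j \<in> J \<Longrightarrow> P j (r *\<^sub>R x) = r *\<^sub>R P j x"
  using P_smul[of j "of_real r" x] by (simp add: smul_of_real)

lemma P_P: "j \<in> J \<Longrightarrow> k \<in> J \<Longrightarrow> P j (P k x) = (if j = k then P k x else 0)"
  by (rule P_unique[where g = "\<lambda>j. if j = k then P k x else 0"])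
    (simp_all add: subspace_0 W_subspace P_in sums_over_single inj_e)

lemma S_add: "S n (x + y) = S n x + S n y"
  by (simp add: S_def P_add sum.distrib)

lemma S_scaleR: "S n (r *\<^sub>R x) = r *\<^sub>R S n x"
  by (simp add: S_def P_scaleR scaleR_sum_right)

text \<open>By injectivity of \<open>e\<close>, exactly one index enters between the stages
  \<open>e j\<close> and \<open>Suc (e j)\<close>. Bounds on \<open>S\<close> thereby become bounds
  on \<open>P\<close>.\<close>

lemma P_eq_S_diff:
  assumes "j \<in> J"
  shows "P j x = S (Suc (e j)) x - S (e j) x"
proof -
  have "{i \<in> J. e i < Suc (e j)} = insert j {i \<in> J. e i < e j}"
    using assms inj_e by (auto simp: less_Suc_eq dest: inj_onD)
  then show ?thesis
    by (simp add: S_def finite_initial_segment inj_e)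
qed

text \<open>
  The closure of the set where all partial sums are bounded by some \<open>N\<close> contains a ball; as in the
  open mapping theorem, successive approximation then writes every small \<open>f\<close> as a series of
  vectors \<open>h k\<close> with partial sums bounded by \<open>N / 2 ^ k\<close>. Summing the expansions of the \<open>h k\<close>
  coordinatewise yields an expansion of \<open>f\<close>, which by uniqueness is the expansion of \<open>f\<close>.
\<close>

lemma S_uniformly_bounded:
  obtains K where "K \<ge> 0" "\<And>n x. norm (S n x) \<le> K * norm x"
proof -
  define A where "A N = {x. \<forall>n. norm (S n x) \<le> real N}" for N
  have conv: "convex (A N)" for N
    unfolding convex_def
  proof (intro ballI allI impI)
    fix x y :: 'a and u v :: real
    assume xy: "x \<in> A N" "y \<in> A N" and uv: "0 \<le> u" "0 \<le> v" "u + v = 1"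
    have "norm (S n (u *\<^sub>R x + v *\<^sub>R y)) \<le> real N" for n
    proof -
      have "norm (S n (u *\<^sub>R x + v *\<^sub>R y)) \<le> u * norm (S n x) + v * norm (S n y)"
        using norm_triangle_ineq[of "u *\<^sub>R S n x" "v *\<^sub>R S n y"] uv by (simp add: S_add S_scaleR)
      also have "\<dots> \<le> u * real N + v * real N"
        using xy uv by (intro add_mono mult_left_mono) (auto simp: A_def)
      also have "\<dots> = real N"
        using uv by (simp flip: distrib_right)
      finally show ?thesis .
    qed
    then show "u *\<^sub>R x + v *\<^sub>R y \<in> A N" by (simp add: A_def)
  qed
  have sym: "- x \<in> A N" if "x \<in> A N" for N x
    using that S_scaleR[of _ "-1" x] by (simp add: A_def)
  have cover: "(\<Union>N. A N) = UNIV"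
  proof -
    have "x \<in> (\<Union>N. A N)" for x
    proof -
      have "Bseq (\<lambda>n. S n x)"
        using S_tendsto[of x] by (intro convergent_imp_Bseq) (auto simp: convergent_def)
      then obtain N :: nat where "\<forall>n. norm (S n x) \<le> real (Suc N)"
        by (auto simp: Bseq_iff)
      then have "x \<in> A (Suc N)" by (simp add: A_def)
      then show ?thesis by blast
    qed
    then show ?thesis by blast
  qed
  obtain N r where r: "r > 0" and ball: "ball 0 r \<subseteq> closure (A N)"
    using baire_ball_in_closure[of A, OF conv sym cover] by blast
  have ex: "\<exists>h. norm y < r / 2 ^ k \<longrightarrow>
      (\<forall>n. norm (S n h) \<le> real N / 2 ^ k) \<and> norm (y - h) < r / 2 ^ Suc k" for k y
  proof (cases "norm y < r / 2 ^ k")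
    case True
    then have "(2 ^ k) *\<^sub>R y \<in> closure (A N)"
      using ball by (auto simp: subset_eq field_simps)
    then obtain h where h: "h \<in> A N" "dist h ((2 ^ k) *\<^sub>R y) < r / 2"
      using half_gt_zero[OF r] unfolding closure_approachable by blast
    have "norm (S n ((1 / 2 ^ k) *\<^sub>R h)) \<le> real N / 2 ^ k" for n
      using h(1) by (simp add: A_def S_scaleR divide_right_mono)
    moreover have "y - (1 / 2 ^ k) *\<^sub>R h = (1 / 2 ^ k) *\<^sub>R ((2 ^ k) *\<^sub>R y - h)"
      by (simp add: scaleR_right_diff_distrib)
    then have "norm (y - (1 / 2 ^ k) *\<^sub>R h) = dist h ((2 ^ k) *\<^sub>R y) / 2 ^ k"
      by (simp only: dist_norm norm_scaleR norm_minus_commute[of h]) simp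
    then have "norm (y - (1 / 2 ^ k) *\<^sub>R h) < r / 2 ^ Suc k"
      using h(2) by (simp add: divide_simps)
    ultimately show ?thesis by blast
  qed simp
  \<comment> \<open>Keeping the size condition as a premise makes the choice total, so that the
    remainders can be defined by plain recursion.\<close>
  define H where "H k y = (SOME h. norm y < r / 2 ^ k \<longrightarrow>
      (\<forall>n. norm (S n h) \<le> real N / 2 ^ k) \<and> norm (y - h) < r / 2 ^ Suc k)" for k y
  have H: "norm y < r / 2 ^ k \<Longrightarrow>
      (\<forall>n. norm (S n (H k y)) \<le> real N / 2 ^ k) \<and> norm (y - H k y) < r / 2 ^ Suc k" for k y
    using someI_ex[OF ex[of y k]] unfolding H_def by blast
  have small: "norm (S n f) \<le> 2 * real N" if f: "norm f < r" for f n
  proof -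
    \<comment> \<open>\<open>y k\<close> is the remainder of \<open>f\<close> after \<open>k\<close>
      approximation steps.\<close>
    define y where "y = rec_nat f (\<lambda>k y. y - H k y)"
    have y0: "y 0 = f" and ySuc: "y (Suc k) = y k - H k (y k)" for k
      by (simp_all add: y_def)
    have y: "norm (y k) < r / 2 ^ k" for k
      by (induction k) (use f H in \<open>simp_all add: y0 ySuc\<close>)
    define h where "h k = H k (y k)" for k
    have Sh: "norm (S n (h k)) \<le> real N * (1 / 2) ^ k" for n k
      using H[OF y] by (simp add: h_def power_one_over)
    \<comment> \<open>The bound on the partial sums \<open>S n (h k)\<close> survives their limit
      \<open>h k\<close>.\<close>
    have h: "norm (h k) \<le> real N * (1 / 2) ^ k" for k
      using tendsto_norm[OF S_tendsto[of "h k"]] Sh[of _ k] by (intro LIMSEQ_le_const2) auto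
    have geo: "(\<lambda>k. c * (1 / 2) ^ k) sums (2 * c)" for c :: real
      using sums_mult[OF geometric_sums[of "1/2::real"], of c] by (simp add: mult.commute)
    have sum_h: "(\<Sum>k<m. h k) = f - y m" for m
      by (induction m) (simp_all add: y0 ySuc h_def)
    have "y \<longlonglongrightarrow> 0"
    proof (rule Lim_null_comparison)
      show "\<forall>\<^sub>F k in sequentially. norm (y k) \<le> r * (1 / 2) ^ k"
        using y by (simp add: less_imp_le power_one_over)
      show "(\<lambda>k. r * (1 / 2) ^ k) \<longlonglongrightarrow> 0"
        using summable_LIMSEQ_zero[OF sums_summable[OF geo]] .
    qed
    then have h_sums: "h sums f"
      unfolding sums_def sum_h using tendsto_diff[OF tendsto_const, of y 0 sequentially f] by simp
    have Ph: "norm (P j (h k)) \<le> (2 * real N) * (1 / 2) ^ k" if "j \<in> J" for j k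
      using norm_triangle_ineq4[of "S (Suc (e j)) (h k)" "S (e j) (h k)"] Sh[of "Suc (e j)" k] Sh[of "e j" k]
      by (simp add: P_eq_S_diff[OF that])
    have summ: "summable (\<lambda>k. P j (h k))" if "j \<in> J" for j
      using Ph[OF that] by (intro summable_comparison_test'[OF sums_summable[OF geo]])
    define g where "g j = (\<Sum>k. P j (h k))" for j
    have gW: "g j \<in> W j" if j: "j \<in> J" for j
      unfolding g_def
    proof (rule closed_sequentially[OF W_closed[OF j] _ summable_LIMSEQ[OF summ[OF j]]])
      show "(\<Sum>k<n. P j (h k)) \<in> W j" for n
        using j by (simp add: subspace_sum W_subspace P_in)
    qed
    have summ_S: "summable (\<lambda>k. S n (h k))" for n
      using Sh by (intro summable_comparison_test'[OF sums_summable[OF geo]])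
    have sum_g: "(\<Sum>j\<in>{j \<in> J. e j < n}. g j) = (\<Sum>k. S n (h k))" for n
      unfolding g_def S_def by (rule suminf_sum[symmetric]) (simp add: summ)
    have dom: "norm (norm (S n (h k) - h k)) \<le> (2 * real N) * (1 / 2) ^ k" for n k
      using norm_triangle_ineq4[of "S n (h k)" "h k"] Sh[of n k] h[of k] by simp
    have dsumm: "summable (\<lambda>k. norm (S n (h k) - h k))" for n
      using dom by (intro summable_comparison_test'[OF sums_summable[OF geo]])
    \<comment> \<open>Each \<open>h k\<close> has a convergent expansion and the errors are
      dominated geometrically in \<open>k\<close>, uniformly in \<open>n\<close>; hence the limit
      may be taken inside the sum.\<close>
    have "(\<lambda>n. \<Sum>k. norm (S n (h k) - h k)) \<longlonglongrightarrow> (\<Sum>k. 0)"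
    proof (rule tannerys_theorem[THEN conjunct2, THEN conjunct2])
      show "(\<lambda>n. norm (S n (h k) - h k)) \<longlonglongrightarrow> 0" for k
        using S_tendsto[of "h k"] LIM_zero tendsto_norm_zero by blast
      show "\<forall>\<^sub>F (k, n) in at_top \<times>\<^sub>F sequentially. norm (norm (S n (h k) - h k)) \<le> (2 * real N) * (1 / 2) ^ k"
        using dom by (intro always_eventually) auto
    qed (simp_all add: sums_summable[OF geo])
    then have lim: "(\<lambda>n. \<Sum>k. norm (S n (h k) - h k)) \<longlonglongrightarrow> 0" by simp
    have le: "norm ((\<Sum>j\<in>{j \<in> J. e j < n}. g j) - f) \<le> (\<Sum>k. norm (S n (h k) - h k))" for n
    proof -
      have "(\<Sum>j\<in>{j \<in> J. e j < n}. g j) - f = (\<Sum>k. S n (h k) - h k)"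
        unfolding sum_g by (rule sums_unique[OF sums_diff[OF summable_sums[OF summ_S] h_sums]])
      then show ?thesis
        using summable_norm[OF dsumm[of n]] by (simp only:)
    qed
    have "sums_over J e g f"
      unfolding sums_over_def
    proof (rule LIM_zero_cancel, rule Lim_null_comparison[OF always_eventually lim])
      show "\<forall>n. norm ((\<Sum>j\<in>{j \<in> J. e j < n}. g j) - f) \<le> (\<Sum>k. norm (S n (h k) - h k))"
        using le by blast
    qed
    \<comment> \<open>Uniqueness of expansions replaces the missing continuity of
      \<open>P j\<close>: it lets \<open>P j\<close> pass through the series of the
      \<open>h k\<close>.\<close>
    then have "P j f = g j" if "j \<in> J" for j
      using gW that by (intro P_unique)
    then have "S n f = (\<Sum>k. S n (h k))"
      unfolding sum_g[symmetric] by (simp add: S_def)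
    also have "norm \<dots> \<le> (\<Sum>k. real N * (1 / 2) ^ k)"
      using Sh by (intro norm_suminf_le sums_summable[OF geo])
    also have "\<dots> = 2 * real N"
      using sums_unique[OF geo] by simp
    finally show ?thesis .
  qed
  have "norm (S n x) \<le> (4 * real N / r) * norm x" for n x
  proof (cases "x = 0")
    case True
    then show ?thesis using S_scaleR[of n 0 x] by simp
  next
    case False
    define c where "c = r / (2 * norm x)"
    have c: "c > 0" using False r by (simp add: c_def)
    have "norm (c *\<^sub>R x) < r"
      using False r by (simp add: c_def)
    from small[OF this, of n] have "c * norm (S n x) \<le> 2 * real N"
      using c by (simp add: S_scaleR)
    then show ?thesis
      using False r by (simp add: c_def field_simps)
  qed
  moreover have "4 * real N / r \<ge> 0" using r by simp
  ultimately show thesis using that by blast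
qed

lemma P_uniformly_bounded:
  obtains K where "K \<ge> 0" "\<And>j x. j \<in> J \<Longrightarrow> norm (P j x) \<le> K * norm x"
proof -
  obtain K where K: "K \<ge> 0" "\<And>n x. norm (S n x) \<le> K * norm x"
    using S_uniformly_bounded by blast
  have "norm (P j x) \<le> (2 * K) * norm x" if "j \<in> J" for j x
    using norm_triangle_ineq4[of "S (Suc (e j)) x" "S (e j) x"] K(2)[of "Suc (e j)" x] K(2)[of "e j" x]
    by (simp add: P_eq_S_diff[OF that])
  with K(1) that[of "2 * K"] show thesis by simp
qed

end

subsection \<open>The dual f-basis\<close>

lemma (in separable_hilbert_space) norm_ip_commute: "norm (ip x y) = norm (ip y x)"
  by (simp only: ip_conj[of y x] norm_conj)

text \<open>An operator bound passes to the adjoint with the same constant. The pointwise form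
  serves both \<open>Q j\<close> and the finite sums \<open>T n\<close>.\<close>

lemma (in separable_hilbert_space) adjoint_bound:
  assumes adj: "\<And>x. ip (A x) y = ip x z" and bound: "\<And>x. norm (A x) \<le> K * norm x" and "K \<ge> 0"
  shows "norm z \<le> K * norm y"
proof (rule norm_le_if_ip_le)
  fix x
  have "norm (ip z x) = norm (ip (A x) y)"
    by (simp add: norm_ip_commute[of z x] adj)
  also have "\<dots> \<le> norm (A x) * norm y" by (rule norm_ip_le)
  also have "\<dots> \<le> (K * norm x) * norm y" by (intro mult_right_mono bound) simp
  finally show "norm (ip z x) \<le> (K * norm y) * norm x" by (simp add: mult_ac)
qed (use \<open>K \<ge> 0\<close> in simp)

context fusion_basis
begin

abbreviation "Q j \<equiv> hilbert_adjoint ip (P j)"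
abbreviation "V j \<equiv> Q j ` W j"

definition "T n y = (\<Sum>j\<in>{j \<in> J. e j < n}. Q j y)"

lemma ip_Q: "j \<in> J \<Longrightarrow> ip (P j x) y = ip x (Q j y)"
proof -
  assume j: "j \<in> J"
  obtain K where "K \<ge> 0" "\<And>j x. j \<in> J \<Longrightarrow> norm (P j x) \<le> K * norm x"
    using P_uniformly_bounded by blast
  then show ?thesis
    using j by (intro ip_hilbert_adjoint[of _ K]) (simp_all add: P_add P_smul)
qed

lemma Q_add: "j \<in> J \<Longrightarrow> Q j (x + y) = Q j x + Q j y"
  by (rule ip_left_cancel) (simp add: ip_add_right flip: ip_Q)

lemma Q_smul: "j \<in> J \<Longrightarrow> Q j (smul c x) = smul c (Q j x)"
  by (rule ip_left_cancel) (simp add: ip_smul_right flip: ip_Q)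

lemma Q_Q:
  assumes "j \<in> J" "k \<in> J"
  shows "Q j (Q k y) = (if j = k then Q k y else 0)"
proof (rule ip_left_cancel)
  fix x
  have "ip x (Q j (Q k y)) = ip (P k (P j x)) y"
    using assms by (simp add: ip_Q)
  then show "ip x (Q j (Q k y)) = ip x (if j = k then Q k y else 0)"
    using assms by (simp add: P_P ip_Q)
qed

lemma ip_T: "ip (S n x) y = ip x (T n y)"
  by (simp add: S_def T_def ip_sum_left ip_sum_right ip_Q)

lemma Q_uniformly_bounded:
  obtains K where "K \<ge> 0" "\<And>j y. j \<in> J \<Longrightarrow> norm (Q j y) \<le> K * norm y"
proof -
  obtain K where K: "K \<ge> 0" "\<And>j x. j \<in> J \<Longrightarrow> norm (P j x) \<le> K * norm x"
    using P_uniformly_bounded by blast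
  have "norm (Q j y) \<le> K * norm y" if j: "j \<in> J" for j y
    by (rule adjoint_bound[OF ip_Q[OF j] K(2)[OF j] K(1)])
  with K(1) that show thesis by blast
qed

lemma T_uniformly_bounded:
  obtains K where "K \<ge> 0" "\<And>n y. norm (T n y) \<le> K * norm y"
proof -
  obtain K where K: "K \<ge> 0" "\<And>n x. norm (S n x) \<le> K * norm x"
    using S_uniformly_bounded by blast
  have "norm (T n y) \<le> K * norm y" for n y
    by (rule adjoint_bound[OF ip_T K(2) K(1)])
  with K(1) that show thesis by blast
qed

lemma bounded_linear_Q: "j \<in> J \<Longrightarrow> bounded_linear (Q j)"
proof -
  assume j: "j \<in> J"
  obtain K where "K \<ge> 0" "\<And>j y. j \<in> J \<Longrightarrow> norm (Q j y) \<le> K * norm y"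
    using Q_uniformly_bounded by blast
  then show ?thesis
    using j by (intro bounded_linearI[of _ K]) (simp_all add: Q_add Q_smul)
qed

lemma T_add: "T n (x + y) = T n x + T n y"
  by (simp add: T_def Q_add sum.distrib)

lemma T_smul: "T n (smul c x) = smul c (T n x)"
  by (simp add: T_def Q_smul scale_sum_right)

text \<open>
  The vectors \<open>y\<close> with \<open>T n y \<longlonglongrightarrow> y\<close> form a closed subspace, since the \<open>T n\<close> are uniformly bounded.
  It contains every \<open>Q j y\<close>, and only \<open>0\<close> is orthogonal to all of these.
\<close>

lemma T_tendsto: "(\<lambda>n. T n y) \<longlonglongrightarrow> y"
proof -
  define M where "M = {y. (\<lambda>n. T n y) \<longlonglongrightarrow> y}"
  obtain K where K: "K \<ge> 0" "\<And>n y. norm (T n y) \<le> K * norm y"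
    using T_uniformly_bounded by blast
  have zero: "T n 0 = 0" for n
    using T_smul[of n 0 0] by simp
  have "bounded_linear (T n)" for n
    using K by (intro bounded_linearI[of _ K]) (simp_all add: T_add T_smul)
  then have T_diff: "T n (x - y) = T n x - T n y" for n x y
    by (rule linear_diff[OF bounded_linear.linear])
  have "subspace M"
    unfolding M_def
    by (rule subspaceI)
      (simp_all add: zero T_add T_smul tendsto_add bounded_linear.tendsto[OF bounded_linear_smul])
  moreover have "closed M"
    unfolding closure_subset_eq[symmetric]
  proof
    fix y assume y: "y \<in> closure M"
    have "(\<lambda>n. T n y) \<longlonglongrightarrow> y"
    proof (rule LIMSEQ_I)
      fix \<epsilon> :: real
      assume \<epsilon>: "\<epsilon> > 0"
      \<comment> \<open>Replacing \<open>y\<close> by \<open>z\<close> costs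
        \<open>K * \<delta>\<close> in \<open>T n\<close> and \<open>\<delta>\<close> in the limit,
        together half of \<open>\<epsilon>\<close>.\<close>
      define \<delta> where "\<delta> = \<epsilon> / (2 * (K + 1))"
      have \<delta>: "\<delta> > 0" "(K + 1) * \<delta> = \<epsilon> / 2"
        using \<epsilon> K(1) by (simp_all add: \<delta>_def divide_simps)
      obtain z where z: "z \<in> M" "dist z y < \<delta>"
        using y \<delta>(1) unfolding closure_approachable by blast
      obtain N where N: "\<And>n. n \<ge> N \<Longrightarrow> norm (T n z - z) < \<epsilon> / 2"
        using LIMSEQ_D[of "\<lambda>n. T n z" z "\<epsilon> / 2"] z(1) \<epsilon> unfolding M_def mem_Collect_eq by (meson half_gt_zero)
      have "norm (T n y - y) < \<epsilon>" if n: "n \<ge> N" for n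
      proof -
        have eq: "T n y - y = (T n (y - z) + (z - y)) + (T n z - z)"
          by (simp add: T_diff)
        have "norm (T n y - y) \<le> norm (T n (y - z)) + norm (z - y) + norm (T n z - z)"
          unfolding eq
          using norm_triangle_ineq[of "T n (y - z) + (z - y)" "T n z - z"]
            norm_triangle_ineq[of "T n (y - z)" "z - y"] by linarith
        moreover have "norm (T n (y - z)) \<le> K * \<delta>"
        proof -
          have "K * norm (y - z) \<le> K * \<delta>"
            using z(2) K(1) by (intro mult_left_mono) (simp_all add: dist_norm norm_minus_commute)
          with K(2)[of n "y - z"] show ?thesis by linarith
        qed
        moreover have "norm (z - y) \<le> \<delta>" using z(2) by (simp add: dist_norm)
        ultimately show ?thesis
          using N[OF n] \<delta>(2) by (simp add: distrib_right)
      qed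
      then show "\<exists>N. \<forall>n\<ge>N. norm (T n y - y) < \<epsilon>" by blast
    qed
    then show "y \<in> M" by (simp add: M_def)
  qed
  moreover have "z = 0" if orth: "\<And>y. y \<in> M \<Longrightarrow> ip z y = 0" for z
  proof -
    \<comment> \<open>Only the term with index \<open>j\<close> survives in
      \<open>T n (Q j y)\<close>, so this sequence is eventually constant.\<close>
    have QM: "Q j y \<in> M" if j: "j \<in> J" for j y
    proof -
      have "sums_over J e (\<lambda>i. if i = j then Q j y else 0) (Q j y)"
        by (rule sums_over_single[OF inj_e j])
      moreover have "(\<Sum>i\<in>{i \<in> J. e i < n}. if i = j then Q j y else 0) = T n (Q j y)" for n
        unfolding T_def using j by (intro sum.cong) (auto simp: Q_Q)
      ultimately show ?thesis by (simp add: sums_over_def M_def)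
    qed
    have "P j z = 0" if j: "j \<in> J" for j
    proof -
      have "ip (P j z) (P j z) = 0"
        unfolding ip_Q[OF j] by (rule orth[OF QM[OF j]])
      then show ?thesis by simp
    qed
    then have "S n z = 0" for n by (simp add: S_def)
    then show "z = 0" using S_tendsto[of z] by (simp add: LIMSEQ_const_iff)
  qed
  ultimately have "M = UNIV"
    by (rule subspace_UNIV_if_orthogonal_trivial)
  then show ?thesis by (auto simp: M_def)
qed

lemma sums_over_Q: "sums_over J e (\<lambda>j. Q j y) y"
  using T_tendsto[of y] by (simp add: sums_over_def T_def)

text \<open>Since \<open>P j\<close> maps into \<open>W j\<close>, its adjoint annihilates the
  orthogonal complement of \<open>W j\<close>; hence \<open>Q j\<close> has the same range on
  \<open>W j\<close> as on the whole space. As the fixed-point set of a bounded idempotent,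
  \<open>V j\<close> is visibly a closed subspace.\<close>

lemma V_eq: "j \<in> J \<Longrightarrow> V j = {v. Q j v = v}"
proof -
  assume j: "j \<in> J"
  have "Q j v \<in> V j" for v
  proof -
    obtain m where m: "m \<in> W j" "\<And>y. y \<in> W j \<Longrightarrow> ip (v - m) y = 0"
      using orthogonal_projection[OF W_subspace[OF j] W_closed[OF j], of v] by blast
    have "ip x (Q j (v - m)) = 0" for x
      unfolding ip_Q[OF j, symmetric] using m(2)[OF P_in[OF j]] ip_eq_0_commute by blast
    then have "Q j (v - m) = 0" using ip_self_eq_0 by blast
    then have "Q j v = Q j m"
      using linear_diff[OF bounded_linear.linear[OF bounded_linear_Q[OF j]]] by simp
    with m(1) show ?thesis by blast
  qed
  then have "v \<in> V j" if "Q j v = v" for v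
    using that by metis
  then show ?thesis
    using j by (auto simp: Q_Q)
qed

text \<open>Existence is \<open>sums_over_Q\<close>. For uniqueness, the continuous map
  \<open>Q j\<close> is applied to an arbitrary expansion of \<open>y\<close>: all terms but the one
  at \<open>j\<close> vanish, which leaves \<open>Q j y = g j\<close>.\<close>

lemma f_basis_V: "f_basis smul J e V"
  and f_dual_V: "j \<in> J \<Longrightarrow> f_dual J e V j = Q j"
proof -
  have "subspace (V j) \<and> closed (V j)" if j: "j \<in> J" for j
  proof
    have bl: "bounded_linear (Q j)" by (rule bounded_linear_Q[OF j])
    show "subspace (V j)"
      using j linear_0[OF bounded_linear.linear[OF bl]] by (auto intro!: subspaceI simp: V_eq Q_add Q_smul)
    show "closed (V j)"
      unfolding V_eq[OF j]
      by (intro closed_Collect_eq linear_continuous_on bl continuous_on_id)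
  qed
  moreover have uni: "\<exists>!g. g \<in> (\<Pi>\<^sub>E j\<in>J. V j) \<and> sums_over J e g y"
    and g_eq: "g \<in> (\<Pi>\<^sub>E j\<in>J. V j) \<Longrightarrow> sums_over J e g y \<Longrightarrow> g = (\<lambda>j\<in>J. Q j y)" for y g
  proof -
    have eq: "g = (\<lambda>j\<in>J. Q j y)" if g: "g \<in> (\<Pi>\<^sub>E j\<in>J. V j)" "sums_over J e g y" for g
    proof -
      have "Q j y = g j" if j: "j \<in> J" for j
      proof -
        have "Q j (g i) = (if i = j then g j else 0)" if i: "i \<in> J" for i
        proof -
          have "g i \<in> V i" using g(1) i by blast
          then have "Q i (g i) = g i" using i by (simp add: V_eq)
          then show ?thesis using Q_Q[OF j i, of "g i"] by auto
        qed
        then have "sums_over J e (\<lambda>i. if i = j then g j else 0) (Q j y)"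
          using sums_over_bounded_linear[OF bounded_linear_Q[OF j] g(2)]
            sums_over_cong[of J "\<lambda>i. Q j (g i)"] by fastforce
        then show ?thesis
          using sums_over_single[OF inj_e j] sums_over_unique by blast
      qed
      moreover have "g j = undefined" if "j \<notin> J" for j
        using g(1) that by (rule PiE_arb)
      ultimately show ?thesis by (auto simp: fun_eq_iff)
    qed
    then show "g \<in> (\<Pi>\<^sub>E j\<in>J. V j) \<Longrightarrow> sums_over J e g y \<Longrightarrow> g = (\<lambda>j\<in>J. Q j y)" .
    have "(\<lambda>j\<in>J. Q j y) \<in> (\<Pi>\<^sub>E j\<in>J. V j) \<and> sums_over J e (\<lambda>j\<in>J. Q j y) y"
      using sums_over_Q[of y] sums_over_cong[of J "\<lambda>j\<in>J. Q j y" "\<lambda>j. Q j y"] by (auto simp: V_eq Q_Q)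
    with eq show "\<exists>!g. g \<in> (\<Pi>\<^sub>E j\<in>J. V j) \<and> sums_over J e g y" by blast
  qed
  ultimately show "f_basis smul J e V"
    unfolding f_basis_def by blast
  show "f_dual J e V j = Q j" if j: "j \<in> J"
  proof
    fix y
    have "(THE g. g \<in> (\<Pi>\<^sub>E j\<in>J. V j) \<and> sums_over J e g y) = (\<lambda>j\<in>J. Q j y)"
      using theI'[OF uni[of y]] g_eq by blast
    with j show "f_dual J e V j y = Q j y" by (simp add: f_dual_def)
  qed
qed

subsection \<open>Bessel and Hilbert f-bases\<close>

lemma sums_over_if_norm_P_square_summable:
  assumes bessel: "\<And>x. (\<lambda>j. (norm (P j x))\<^sup>2) summable_on J" and g: "g \<in> l2_sum J V"
  shows "\<exists>f. sums_over J e g f"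
proof -
  \<comment> \<open>Restriction to finite \<open>F\<close> makes these seminorms continuous; square
    summability bounds them at each \<open>x\<close>.\<close>
  define p where "p F x = L2_set (\<lambda>j. norm (P j x)) F" for F x
  define \<F> where "\<F> = {F. finite F \<and> F \<subseteq> J}"
  obtain C where C: "\<And>j x. j \<in> J \<Longrightarrow> norm (P j x) \<le> C * norm x"
    using P_uniformly_bounded by blast
  have blP: "bounded_linear (P j)" if "j \<in> J" for j
    using that C by (intro bounded_linearI[of _ C]) (simp_all add: P_add P_smul)
  have cont: "continuous_on UNIV (p F)" if "F \<in> \<F>" for F
    using that unfolding p_def L2_set_def \<F>_def
    by (intro continuous_intros linear_continuous_on blP) auto
  have sub: "p F (x + y) \<le> p F x + p F y" if "F \<in> \<F>" for F x y
  proof -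
    have "p F (x + y) \<le> L2_set (\<lambda>j. norm (P j x) + norm (P j y)) F"
      using that unfolding p_def \<F>_def
      by (intro L2_set_mono) (auto simp: P_add norm_triangle_ineq)
    also have "\<dots> \<le> p F x + p F y"
      unfolding p_def by (rule L2_set_triangle_ineq)
    finally show ?thesis .
  qed
  have hom: "p F (c *\<^sub>R x) = \<bar>c\<bar> * p F x" if "F \<in> \<F>" for F c x
  proof -
    have "p F (c *\<^sub>R x) = L2_set (\<lambda>j. \<bar>c\<bar> * norm (P j x)) F"
      using that unfolding p_def \<F>_def by (intro L2_set_cong) (auto simp: P_scaleR)
    then show ?thesis by (simp add: p_def L2_set_right_distrib)
  qed
  have bdd: "\<exists>B. \<forall>F\<in>\<F>. p F x \<le> B" for x
  proof (intro exI ballI)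
    fix F assume "F \<in> \<F>"
    then show "p F x \<le> sqrt (\<Sum>\<^sub>\<infinity>j\<in>J. (norm (P j x))\<^sup>2)"
      unfolding p_def L2_set_def \<F>_def
      by (intro real_sqrt_le_mono finite_sum_le_infsum bessel) auto
  qed
  obtain K where K: "K \<ge> 0" "\<And>F x. F \<in> \<F> \<Longrightarrow> p F x \<le> K * norm x"
    using seminorms_uniformly_bounded[of \<F> p, OF cont sub hom bdd] by blast
  have gV: "Q j (g j) = g j" if j: "j \<in> J" for j
  proof -
    have "g \<in> (\<Pi>\<^sub>E j\<in>J. V j)" using g by (simp add: l2_sum_def)
    then have "g j \<in> V j" using j by (rule PiE_mem)
    then show ?thesis by (simp only: V_eq[OF j] mem_Collect_eq)
  qed
  \<comment> \<open>Since \<open>Q j\<close> fixes \<open>g j\<close>, testing against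
    \<open>x\<close> replaces \<open>x\<close> by \<open>P j x\<close> in each term; Cauchy-Schwarz
    for finite sums then brings in \<open>p F x\<close>.\<close>
  have est: "norm (sum g F) \<le> K * L2_set (\<lambda>j. norm (g j)) F" if F: "F \<in> \<F>" for F
  proof (rule norm_le_if_ip_le)
    fix x
    have "ip x (sum g F) = (\<Sum>j\<in>F. ip (P j x) (g j))"
      unfolding ip_sum_right using F gV by (intro sum.cong) (auto simp: ip_Q \<F>_def)
    then have "norm (ip (sum g F) x) = norm (\<Sum>j\<in>F. ip (P j x) (g j))"
      by (simp add: norm_ip_commute[of "sum g F" x])
    also have "\<dots> \<le> (\<Sum>j\<in>F. \<bar>norm (P j x)\<bar> * \<bar>norm (g j)\<bar>)"
      by (rule sum_norm_le) (simp add: norm_ip_le)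
    also have "\<dots> \<le> p F x * L2_set (\<lambda>j. norm (g j)) F"
      unfolding p_def by (rule L2_set_mult_ineq)
    also have "\<dots> \<le> (K * norm x) * L2_set (\<lambda>j. norm (g j)) F"
      by (intro mult_right_mono K F L2_set_nonneg)
    finally show "norm (ip (sum g F) x) \<le> (K * L2_set (\<lambda>j. norm (g j)) F) * norm x"
      by (simp add: mult_ac)
  qed (use K(1) in simp)
  define s where "s n = (\<Sum>j\<in>{j \<in> J. e j < n}. (norm (g j))\<^sup>2)" for n
  have "incseq s"
    unfolding s_def by (intro incseq_SucI sum_mono2) (auto simp: finite_initial_segment inj_e)
  moreover have "s n \<le> (\<Sum>\<^sub>\<infinity>j\<in>J. (norm (g j))\<^sup>2)" for n
    unfolding s_def using g
    by (intro finite_sum_le_infsum) (auto simp: l2_sum_def finite_initial_segment inj_e)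
  ultimately have "convergent s"
    by (metis incseq_convergent convergentI)
  then have "Cauchy s" by (rule convergent_Cauchy)
  define U where "U n = (\<Sum>j\<in>{j \<in> J. e j < n}. g j)" for n
  have step: "norm (U n - U m) \<le> K * sqrt \<bar>s n - s m\<bar>" if mn: "m \<le> n" for m n
  proof -
    define F where "F = {j \<in> J. e j < n} - {j \<in> J. e j < m}"
    have sub: "{j \<in> J. e j < m} \<subseteq> {j \<in> J. e j < n}" using mn by auto
    have "U n - U m = sum g F" "s n - s m = (\<Sum>j\<in>F. (norm (g j))\<^sup>2)"
      unfolding U_def s_def F_def by (simp_all add: sum_diff finite_initial_segment inj_e sub)
    moreover have "F \<in> \<F>"
      by (auto simp: F_def \<F>_def finite_initial_segment inj_e)
    ultimately show ?thesis
      using est[of F] by (simp add: L2_set_def sum_nonneg)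
  qed
  have "Cauchy U"
  proof (rule metric_CauchyI)
    fix \<epsilon> :: real
    assume \<epsilon>: "\<epsilon> > 0"
    \<comment> \<open>The summand 1 gives \<open>K * \<delta> < \<epsilon>\<close> strictly, also
      for \<open>K = 0\<close>.\<close>
    define \<delta> where "\<delta> = \<epsilon> / (K + 1)"
    have \<delta>: "\<delta> > 0" "(K + 1) * \<delta> = \<epsilon>" using \<epsilon> K(1) by (simp_all add: \<delta>_def)
    obtain N where N: "\<And>m n. m \<ge> N \<Longrightarrow> n \<ge> N \<Longrightarrow> dist (s m) (s n) < \<delta>\<^sup>2"
      using metric_CauchyD[OF \<open>Cauchy s\<close>, of "\<delta>\<^sup>2"] \<delta>(1) by auto
    have le: "norm (U n - U m) < \<epsilon>" if "m \<ge> N" "n \<ge> N" "m \<le> n" for m n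
    proof -
      have "sqrt \<bar>s n - s m\<bar> \<le> \<delta>"
        using N[of n m] that \<delta>(1) by (intro real_le_lsqrt) (simp_all add: dist_real_def)
      then have "K * sqrt \<bar>s n - s m\<bar> \<le> K * \<delta>"
        using K(1) by (rule mult_left_mono)
      with step[OF that(3)] \<delta> show ?thesis by (simp add: distrib_right)
    qed
    have "dist (U m) (U n) < \<epsilon>" if "m \<ge> N" "n \<ge> N" for m n
      using le[of m n] le[of n m] that by (cases "m \<le> n") (simp_all add: dist_norm norm_minus_commute)
    then show "\<exists>N. \<forall>m\<ge>N. \<forall>n\<ge>N. dist (U m) (U n) < \<epsilon>" by blast
  qed
  then obtain L where "U \<longlonglongrightarrow> L"
    unfolding Cauchy_convergent_iff convergent_def by blast
  then show ?thesis
    unfolding sums_over_def U_def by blast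
qed

text \<open>
  If \<open>\<Sum>j. (norm (P j f))\<^sup>2\<close> diverged, Abel--Dini would give square summable coefficients \<open>a\<close> with
  \<open>\<Sum>j. a j * norm (P j f)\<close> divergent; but these are the inner products of \<open>f\<close> with the partial
  sums of a square summable family in the \<open>V j\<close>.
\<close>

lemma norm_P_square_summable_if_hilbert:
  assumes hilbert: "\<And>g. g \<in> l2_sum J V \<Longrightarrow> \<exists>h. sums_over J e g h"
  shows "(\<lambda>j. (norm (P j f))\<^sup>2) summable_on J"
proof (rule ccontr)
  assume not: "\<not> ?thesis"
  define b where "b k = (if k \<in> e ` J then norm (P (the_inv_into J e k) f) else 0)" for k
  have b_e: "b (e j) = norm (P j f)" if "j \<in> J" for j
    using that inj_e by (simp add: b_def the_inv_into_f_f)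
  have reindex: "(\<Sum>j\<in>{j \<in> J. e j < n}. c (e j)) = (\<Sum>k<n. c k)"
    if "\<And>k. k \<notin> e ` J \<Longrightarrow> c k = 0" for c :: "nat \<Rightarrow> real" and n
  proof -
    have "(if k \<in> e ` J then c (e (the_inv_into J e k)) else 0) = c k" for k
      using that[of k] inj_e by (auto simp: f_the_inv_into_f the_inv_into_f_f)
    then show ?thesis
      using sum_initial_segment[OF inj_e, of "\<lambda>j. c (e j)" n] by simp
  qed
  have "\<not> summable (\<lambda>k. (b k)\<^sup>2)"
  proof
    assume summ: "summable (\<lambda>k. (b k)\<^sup>2)"
    have "(\<lambda>j. (norm (P j f))\<^sup>2) summable_on J"
    proof (rule summable_on_if_initial_sums_bounded[OF inj_e])
      fix n
      have "(\<Sum>j\<in>{j \<in> J. e j < n}. (norm (P j f))\<^sup>2) = (\<Sum>j\<in>{j \<in> J. e j < n}. (b (e j))\<^sup>2)"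
        by (intro sum.cong) (auto simp: b_e)
      also have "\<dots> = (\<Sum>k<n. (b k)\<^sup>2)"
        by (rule reindex[of "\<lambda>k. (b k)\<^sup>2"]) (simp add: b_def)
      also have "\<dots> \<le> (\<Sum>k. (b k)\<^sup>2)"
        by (intro sum_le_suminf summ) auto
      finally show "(\<Sum>j\<in>{j \<in> J. e j < n}. (norm (P j f))\<^sup>2) \<le> (\<Sum>k. (b k)\<^sup>2)" .
    qed simp
    with not show False by simp
  qed
  then obtain a where a: "summable (\<lambda>k. (a k)\<^sup>2)" "\<not> summable (\<lambda>k. a k * b k)"
    and a0: "\<And>k. b k = 0 \<Longrightarrow> a k = 0"
    using abel_dini[of b] by blast
  have a0': "a k = 0" if "k \<notin> e ` J" for k
    using that by (intro a0) (simp add: b_def)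
  obtain K where K: "K \<ge> 0" "\<And>j y. j \<in> J \<Longrightarrow> norm (Q j y) \<le> K * norm y"
    using Q_uniformly_bounded by blast
  \<comment> \<open>The coefficient is placed along the normalised \<open>P j f\<close>, so that
    pairing with \<open>f\<close> gives \<open>a (e j) * norm (P j f)\<close>. If
    \<open>P j f = 0\<close>, the scaled vector is zero and so is the product.\<close>
  define g where "g = (\<lambda>j\<in>J. Q j ((a (e j) / norm (P j f)) *\<^sub>R P j f))"
  have norm_g: "norm (g j) \<le> K * \<bar>a (e j)\<bar>" if j: "j \<in> J" for j
  proof -
    have "norm ((a (e j) / norm (P j f)) *\<^sub>R P j f) \<le> \<bar>a (e j)\<bar>"
      by (cases "P j f = 0") simp_all
    then have "K * norm ((a (e j) / norm (P j f)) *\<^sub>R P j f) \<le> K * \<bar>a (e j)\<bar>"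
      using K(1) by (rule mult_left_mono)
    with K(2)[OF j, of "(a (e j) / norm (P j f)) *\<^sub>R P j f"] j show ?thesis by (simp add: g_def)
  qed
  have "(\<lambda>j. (norm (g j))\<^sup>2) summable_on J"
  proof (rule summable_on_if_initial_sums_bounded[OF inj_e])
    fix n
    have "(\<Sum>j\<in>{j \<in> J. e j < n}. (norm (g j))\<^sup>2) \<le> (\<Sum>j\<in>{j \<in> J. e j < n}. K\<^sup>2 * (a (e j))\<^sup>2)"
    proof (rule sum_mono)
      fix j assume "j \<in> {j \<in> J. e j < n}"
      then have "(norm (g j))\<^sup>2 \<le> (K * \<bar>a (e j)\<bar>)\<^sup>2"
        by (intro power_mono norm_g) auto
      then show "(norm (g j))\<^sup>2 \<le> K\<^sup>2 * (a (e j))\<^sup>2" by (simp add: power_mult_distrib)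
    qed
    also have "\<dots> = K\<^sup>2 * (\<Sum>k<n. (a k)\<^sup>2)"
      using reindex[of "\<lambda>k. (a k)\<^sup>2" n] a0' by (simp flip: sum_distrib_left)
    also have "\<dots> \<le> K\<^sup>2 * (\<Sum>k. (a k)\<^sup>2)"
      by (intro mult_left_mono sum_le_suminf a(1)) auto
    finally show "(\<Sum>j\<in>{j \<in> J. e j < n}. (norm (g j))\<^sup>2) \<le> K\<^sup>2 * (\<Sum>k. (a k)\<^sup>2)" .
  qed simp
  moreover have "g \<in> (\<Pi>\<^sub>E j\<in>J. V j)"
    using W_subspace P_in by (auto simp: g_def intro!: imageI subspace_scaleR)
  ultimately have "g \<in> l2_sum J V"
    by (simp add: l2_sum_def)
  then obtain h where "sums_over J e g h" using hilbert by blast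
  then have "(\<lambda>n. ip (\<Sum>j\<in>{j \<in> J. e j < n}. g j) f) \<longlonglongrightarrow> ip h f"
    unfolding sums_over_def by (rule bounded_linear.tendsto[OF bounded_linear_ip_left])
  moreover have "ip (\<Sum>j\<in>{j \<in> J. e j < n}. g j) f = of_real (\<Sum>k<n. a k * b k)" for n
  proof -
    have "ip (g j) f = of_real (a (e j) * b (e j))" if j: "j \<in> J" for j
    proof -
      have "ip f (g j) = ip (P j f) ((a (e j) / norm (P j f)) *\<^sub>R P j f)"
        using j by (simp add: g_def ip_Q)
      from arg_cong[OF this, of conj]
      have "ip (g j) f = ip ((a (e j) / norm (P j f)) *\<^sub>R P j f) (P j f)"
        by (simp only: flip: ip_conj)
      also have "\<dots> = of_real (a (e j) / norm (P j f) * (norm (P j f))\<^sup>2)"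
        by (simp only: ip_scaleR_left ip_norm of_real_mult)
      also have "a (e j) / norm (P j f) * (norm (P j f))\<^sup>2 = a (e j) * b (e j)"
        using j by (simp add: b_e power2_eq_square)
      finally show ?thesis .
    qed
    then have "ip (\<Sum>j\<in>{j \<in> J. e j < n}. g j) f = of_real (\<Sum>j\<in>{j \<in> J. e j < n}. a (e j) * b (e j))"
      unfolding ip_sum_left of_real_sum by (intro sum.cong) auto
    also have "(\<Sum>j\<in>{j \<in> J. e j < n}. a (e j) * b (e j)) = (\<Sum>k<n. a k * b k)"
      using a0' by (intro reindex[of "\<lambda>k. a k * b k"]) simp
    finally show ?thesis .
  qed
  \<comment> \<open>The limit \<open>ip h f\<close> is only known to lie in \<open>'k\<close>; as
    \<open>of_real\<close> is isometric, the Cauchy property descends to the reals.\<close>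
  ultimately have "Cauchy (\<lambda>n. of_real (\<Sum>k<n. a k * b k) :: 'k)"
    using LIMSEQ_imp_Cauchy by (simp only:)
  then have "Cauchy (\<lambda>n. \<Sum>k<n. a k * b k)"
    unfolding Cauchy_def dist_of_real .
  then have "summable (\<lambda>k. a k * b k)"
    by (simp add: summable_iff_convergent Cauchy_convergent_iff)
  with a(2) show False by simp
qed

text \<open>The families in the \<open>W j\<close> with convergent series are exactly the coordinate
  families of vectors \<open>x\<close>.\<close>

lemma bessel_f_basis_iff: "bessel_f_basis smul J e W \<longleftrightarrow> (\<forall>x. (\<lambda>j. (norm (P j x))\<^sup>2) summable_on J)"
proof
  assume bessel: "bessel_f_basis smul J e W"
  show "\<forall>x. (\<lambda>j. (norm (P j x))\<^sup>2) summable_on J"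
  proof
    fix x
    have "(\<lambda>j\<in>J. P j x) \<in> (\<Pi>\<^sub>E j\<in>J. W j)" "sums_over J e (\<lambda>j\<in>J. P j x) x"
      using P_in sums_over_P[of x] sums_over_cong[of J "\<lambda>j\<in>J. P j x" "\<lambda>j. P j x"] by auto
    then have "(\<lambda>j\<in>J. P j x) \<in> l2_sum J W"
      using bessel unfolding bessel_f_basis_def by blast
    then have "(\<lambda>j. (norm ((\<lambda>j\<in>J. P j x) j))\<^sup>2) summable_on J"
      by (simp add: l2_sum_def)
    then show "(\<lambda>j. (norm (P j x))\<^sup>2) summable_on J"
      by (rule summable_on_cong[THEN iffD1, rotated]) simp
  qed
next
  assume summ: "\<forall>x. (\<lambda>j. (norm (P j x))\<^sup>2) summable_on J"
  have "g \<in> l2_sum J W" if g: "g \<in> (\<Pi>\<^sub>E j\<in>J. W j)" "sums_over J e g x" for g x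
  proof -
    have "P j x = g j" if "j \<in> J" for j
      using g that by (intro P_unique) auto
    then have "(\<lambda>j. (norm (g j))\<^sup>2) summable_on J"
      using summ summable_on_cong[of J "\<lambda>j. (norm (P j x))\<^sup>2" "\<lambda>j. (norm (g j))\<^sup>2"] by simp
    with g(1) show ?thesis by (simp add: l2_sum_def)
  qed
  with basis show "bessel_f_basis smul J e W"
    unfolding bessel_f_basis_def by blast
qed

lemma hilbert_f_basis_V_iff:
  "hilbert_f_basis smul J e V \<longleftrightarrow> (\<forall>x. (\<lambda>j. (norm (P j x))\<^sup>2) summable_on J)"
  using f_basis_V sums_over_if_norm_P_square_summable norm_P_square_summable_if_hilbert unfolding hilbert_f_basis_def by blast

end

text \<open>A given system \<open>P\<close> agrees with \<open>f_dual\<close> only on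
  \<open>J\<close>, so the subspaces built from either may differ elsewhere. The dual functions
  agree even there, because the subspaces enter them only through the product over
  \<open>J\<close>.\<close>

lemma f_basis_cong:
  assumes "\<And>j. j \<in> J \<Longrightarrow> W j = V j"
  shows "f_basis smul J e W \<longleftrightarrow> f_basis smul J e V"
    and "hilbert_f_basis smul J e W \<longleftrightarrow> hilbert_f_basis smul J e V"
    and "f_dual J e W = f_dual J e V"
proof -
  have eq: "(\<Pi>\<^sub>E j\<in>J. W j) = (\<Pi>\<^sub>E j\<in>J. V j)"
    using assms by (intro PiE_cong)
  then show fb: "f_basis smul J e W \<longleftrightarrow> f_basis smul J e V"
    using assms by (simp add: f_basis_def)
  show "hilbert_f_basis smul J e W \<longleftrightarrow> hilbert_f_basis smul J e V"
    by (simp add: hilbert_f_basis_def fb l2_sum_def eq)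
  show "f_dual J e W = f_dual J e V"
    by (simp add: f_dual_def eq fun_eq_iff)
qed

theorem theorem2p14:
  fixes smul :: "'k::conj_field \<Rightarrow> 'a::banach \<Rightarrow> 'a"
    and ip :: "'a \<Rightarrow> 'a \<Rightarrow> 'k"
    and J :: "'i set" and e :: "'i \<Rightarrow> nat"
    and W :: "'i \<Rightarrow> 'a set" and P :: "'i \<Rightarrow> 'a \<Rightarrow> 'a"
  assumes "separable_hilbert_space smul ip"
    and "inj_on e J"
    and "f_basis_system smul J e W P"
  shows "bessel_f_basis_system smul J e W P \<longleftrightarrow>
    hilbert_f_basis_system smul J e
      (\<lambda>j. hilbert_adjoint ip (P j) ` W j) (\<lambda>j. hilbert_adjoint ip (P j))"
proof -
  interpret fusion_basis smul ip J e W
    using assms by (simp add: fusion_basis_def fusion_basis_axioms_def f_basis_system_def)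
  have P: "P j = f_dual J e W j" if "j \<in> J" for j
    using assms(3) that by (simp add: f_basis_system_def)
  let ?V = "\<lambda>j. hilbert_adjoint ip (P j) ` W j"
  have V: "?V j = V j" if "j \<in> J" for j
    using P[OF that] by simp
  have fb: "f_basis smul J e ?V" and dual: "f_dual J e ?V = f_dual J e V"
    and hb: "hilbert_f_basis smul J e ?V \<longleftrightarrow> hilbert_f_basis smul J e V"
    using f_basis_cong[of J ?V V, OF V] f_basis_V by blast+
  have "f_basis_system smul J e ?V (\<lambda>j. hilbert_adjoint ip (P j))"
    using fb f_dual_V P by (simp add: f_basis_system_def dual)
  then show ?thesis
    using assms(3) bessel_f_basis_iff hilbert_f_basis_V_iff hb
    by (simp add: bessel_f_basis_system_def hilbert_f_basis_system_def)
qed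

end
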